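(* Let $Z=\{(P_1,m_1),\ldots,(P_s,m_s)\}\subseteq\mathbb{P}^n$ be a non-homogeneous fat point scheme with $\operatorname{Supp}(Z)=X=CI(d_1,\ldots,d_n)$ a complete intersection of points. Set $M=\max\{m_i\}_{i=1}^s$ and $m=\min\{m_i\}_{i=1}^s$. Then for all $i$, \[ \sum_{(a_1,\ldots,a_n)\in\mathcal{L}_{n,m}} H_{R/I_X}(i-a_1d_1-\cdots-a_nd_n) \leq H_{R/I_Z}(i) \leq \sum_{(a_1,\ldots,a_n)\in\mathcal{L}_{n,M}} H_{R/I_X}(i-a_1d_1-\cdots-a_nd_n). \] In particular: \begin{enumerate} \item[(i)] $md_1\leq\alpha(Z)\leq Md_1$. \item[(ii)] $d_1+\cdots+d_{n-1}+md_n-n\leq\operatorname{ri}(Z)\leq d_1+\cdots+d_{n-1}+Md_n-n$. \end{enumerate}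
   Context: $k$ is an algebraically closed field of characteristic $0$, $R=k[x_0,\ldots,x_n]$ has the standard grading, and $\mathbb{P}^n=\mathbb{P}^n_k$. For distinct points $P_1,\ldots,P_s\in\mathbb{P}^n$ and positive integers $m_1,\ldots,m_s$, the fat point scheme $Z=\{(P_1,m_1),\ldots,(P_s,m_s)\}$ is the subscheme of $\mathbb{P}^n$ defined by $I_Z=\wp_1^{m_1}\cap\cdots\cap\wp_s^{m_s}$, where $\wp_i\subseteq R$ is the defining ideal of $P_i$. Its support is $\operatorname{Supp}(Z)=\{P_1,\ldots,P_s\}$. $Z$ is homogeneous if $m_1=\cdots=m_s$, and non-homogeneous otherwise. A complete intersection of points $X=CI(d_1,\ldots,d_n)\subseteq\mathbb{P}^n$ is a set of $\prod_{i=1}^n d_i$ reduced points whose defining ideal is $I_X=(F_1,\ldots,F_n)$, where $F_1,\ldots,F_n$ is a regular sequence of homogeneous forms with $\deg F_i=d_i$ and $I_X=\sqrt{I_X}$; the type is ordered so that $d_1\leq\cdots\leq d_n$. For a homogeneous ideal $J\subseteq R$, $H_{R/J}(i):=\dim_k(R/J)_i$, which is $0$ for $i<0$. With $\mathbb{N}$ the non-negative integers, $\mathcal{L}_{r,t} := \{(a_1,\ldots,a_r)\in\mathbb{N}^r \mid a_1+\cdots+a_r\leq t-1\}$. Finally, \[ \alpha(Z):=\min\{i\mid (I_Z)_i\neq 0\},\qquad \operatorname{ri}(Z):=\min\left\{i \;\middle|\; H_{R/I_Z}(i)=\deg(Z):=\sum_{j=1}^s\binom{n+m_j-1}{n}\right\}.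 \] *)

theory Defs
  imports
    "HOL-Analysis.Cartesian_Space"
    "HOL-Library.Poly_Mapping"
    "HOL-Library.FuncSet"
    "HOL-Computational_Algebra.Polynomial"
begin

text \<open>
  The ring \<open>R = k[x\<^sub>0,\<dots>,x\<^sub>n]\<close> is the type of finitely supported functions from exponent vectors
  \<open>'v \<Rightarrow>\<^sub>0 nat\<close> to \<open>k\<close>, with the convolution product; the variables are indexed by a finite
  type \<open>'v\<close> with \<open>n + 1\<close> elements.
\<close>

type_synonym ('a, 'v) mpoly = "('v \<Rightarrow>\<^sub>0 nat) \<Rightarrow>\<^sub>0 'a"

definition eval_mpoly :: "('a::comm_ring_1, 'v::finite) mpoly \<Rightarrow> 'a ^ 'v \<Rightarrow> 'a" where
  "eval_mpoly f v =
     (\<Sum>e\<in>Poly_Mapping.keys f. Poly_Mapping.lookup f e * (\<Prod>i\<in>UNIV. v $ i ^ Poly_Mapping.lookup e i))"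

text \<open>The graded piece \<open>R\<^sub>d\<close>; it contains \<open>0\<close>.\<close>

definition forms :: "nat \<Rightarrow> ('a::comm_ring_1, 'v::finite) mpoly set" where
  "forms d = {f. \<forall>e\<in>Poly_Mapping.keys f. (\<Sum>i\<in>UNIV. Poly_Mapping.lookup e i) = d}"


text \<open>
  A commutative ring is a module over itself; its submodules (\<open>ideal.subspace\<close>) are the ideals
  and \<open>ideal.span S\<close> is the ideal generated by \<open>S\<close>.
\<close>

global_interpretation ideal: module "(*) :: 'a::comm_ring_1 \<Rightarrow> 'a \<Rightarrow> 'a"
  by unfold_locales (simp_all add: algebra_simps)

definition ideal_mult :: "'a::comm_ring_1 set \<Rightarrow> 'a set \<Rightarrow> 'a set" where
  "ideal_mult I J = ideal.span {a * b | a b. a \<in> I \<and> b \<in> J}"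

primrec ideal_power :: "'a::comm_ring_1 set \<Rightarrow> nat \<Rightarrow> 'a set" where
  "ideal_power I 0 = UNIV"
| "ideal_power I (Suc r) = ideal_mult I (ideal_power I r)"

definition radical :: "'a::comm_ring_1 set \<Rightarrow> 'a set" where
  "radical I = {f. \<exists>r. f ^ r \<in> I}"

definition regular_sequence :: "nat \<Rightarrow> (nat \<Rightarrow> 'a::comm_ring_1) \<Rightarrow> bool" where
  "regular_sequence r F \<longleftrightarrow>
     (\<forall>j\<in>{1..r}. \<forall>g. F j * g \<in> ideal.span (F ` {1..<j}) \<longrightarrow> g \<in> ideal.span (F ` {1..<j})) \<and>
     ideal.span (F ` {1..r}) \<noteq> UNIV"


text \<open>Points of \<open>\<P>\<^sup>n\<close> are the lines through the origin in \<open>k\<^sup>n\<^sup>+\<^sup>1\<close>.\<close>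

definition proj_space :: "('a::field ^ 'v::finite) set set" where
  "proj_space = {vec.span {v} | v. v \<noteq> 0}"

text \<open>
  The homogeneous defining ideal of a set of points; for a single point \<open>P\<close> it is the
  prime ideal \<open>\<wp>\<close> of \<open>P\<close>.
\<close>

definition vanishing_ideal :: "('a::field ^ 'v::finite) set set \<Rightarrow> ('a, 'v) mpoly set" where
  "vanishing_ideal X =
     ideal.span {f. (\<exists>d. f \<in> forms d) \<and> (\<forall>P\<in>X. \<forall>v\<in>P. eval_mpoly f v = 0)}"

definition complete_intersection ::
  "nat \<Rightarrow> (nat \<Rightarrow> nat) \<Rightarrow> ('a::field ^ 'v::finite) set set \<Rightarrow> bool" where
  "complete_intersection n d X \<longleftrightarrow>
     X \<subseteq> proj_space \<and> finite X \<and> card X = (\<Prod>j=1..n. d j) \<and> mono_on {1..n} d \<and>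
     (\<exists>F. (\<forall>j\<in>{1..n}. F j \<in> forms (d j)) \<and> regular_sequence n F \<and>
          vanishing_ideal X = ideal.span (F ` {1..n})) \<and>
     radical (vanishing_ideal X) = vanishing_ideal X"


text \<open>
  A scheme \<open>{(P\<^sub>1,m\<^sub>1),\<dots>,(P\<^sub>s,m\<^sub>s)}\<close> is given by \<open>s\<close> and functions \<open>P\<close>, \<open>\<mu>\<close> of which only the
  values on \<open>{1..s}\<close> matter.
\<close>

definition fat_point_scheme ::
  "nat \<Rightarrow> (nat \<Rightarrow> ('a::field ^ 'v::finite) set) \<Rightarrow> (nat \<Rightarrow> nat) \<Rightarrow> bool" where
  "fat_point_scheme s P \<mu> \<longleftrightarrow>
     P ` {1..s} \<subseteq> proj_space \<and> inj_on P {1..s} \<and> (\<forall>j\<in>{1..s}. \<mu> j > 0)"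

definition homogeneous_scheme :: "nat \<Rightarrow> (nat \<Rightarrow> nat) \<Rightarrow> bool" where
  "homogeneous_scheme s \<mu> \<longleftrightarrow> (\<forall>i\<in>{1..s}. \<forall>j\<in>{1..s}. \<mu> i = \<mu> j)"

definition fat_ideal ::
  "nat \<Rightarrow> (nat \<Rightarrow> ('a::field ^ 'v::finite) set) \<Rightarrow> (nat \<Rightarrow> nat) \<Rightarrow> ('a, 'v) mpoly set" where
  "fat_ideal s P \<mu> = (\<Inter>j\<in>{1..s}. ideal_power (vanishing_ideal {P j}) (\<mu> j))"

definition scheme_degree :: "nat \<Rightarrow> nat \<Rightarrow> (nat \<Rightarrow> nat) \<Rightarrow> nat" where
  "scheme_degree n s \<mu> = (\<Sum>j=1..s. (n + \<mu> j - 1) choose n)"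


text \<open>
  \<open>basis_mod V W B\<close>: the classes of the elements of \<open>B\<close> are pairwise distinct and form a basis of
  the image of \<open>V\<close> in \<open>R/W\<close>. The scalar \<open>c \<in> k\<close> acts as multiplication by the constant polynomial
  \<open>single 0 c\<close>.
\<close>

definition basis_mod ::
  "('a::field, 'v::finite) mpoly set \<Rightarrow> ('a, 'v) mpoly set \<Rightarrow> ('a, 'v) mpoly set \<Rightarrow> bool" where
  "basis_mod V W B \<longleftrightarrow>
     finite B \<and> B \<subseteq> V \<and>
     (\<forall>f\<in>V. \<exists>c. f - (\<Sum>b\<in>B. Poly_Mapping.single 0 (c b) * b) \<in> W) \<and>
     (\<forall>c. (\<Sum>b\<in>B. Poly_Mapping.single 0 (c b) * b) \<in> W \<longrightarrow> (\<forall>b\<in>B. c b = 0))"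

definition quotient_dim ::
  "('a::field, 'v::finite) mpoly set \<Rightarrow> ('a, 'v) mpoly set \<Rightarrow> nat" where
  "quotient_dim V W = (THE d. \<exists>B. basis_mod V W B \<and> card B = d)"

text \<open>\<open>hilbert J i\<close> is \<open>H\<^bsub>R/J\<^esub>(i)\<close>, the dimension of the image of \<open>R\<^sub>i\<close> in \<open>R/J\<close>.\<close>

definition hilbert :: "('a::field, 'v::finite) mpoly set \<Rightarrow> int \<Rightarrow> nat" where
  "hilbert J i = (if i < 0 then 0 else quotient_dim (forms (nat i)) J)"

definition initial_degree :: "('a::field, 'v::finite) mpoly set \<Rightarrow> nat" where
  "initial_degree J = (LEAST i. J \<inter> forms i \<noteq> {0})"

text \<open>
  The minimum may be taken over \<open>i \<ge> 0\<close>: the Hilbert function is \<open>0\<close> in negative degrees,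
  whereas the degree of a nonempty scheme is positive.
\<close>

definition regularity_index ::
  "nat \<Rightarrow> nat \<Rightarrow> (nat \<Rightarrow> ('a::field ^ 'v::finite) set) \<Rightarrow> (nat \<Rightarrow> nat) \<Rightarrow> nat" where
  "regularity_index n s P \<mu> = (LEAST i. hilbert (fat_ideal s P \<mu>) (int i) = scheme_degree n s \<mu>)"

text \<open>
  Tuples in \<open>\<nat>\<^sup>r\<close> are extensional functions on \<open>{1..r}\<close>. The bound \<open>a\<^sub>1 + \<dots> + a\<^sub>r \<le> t - 1\<close> is
  written strictly because subtraction on \<open>nat\<close> truncates.
\<close>

definition lattice_simplex :: "nat \<Rightarrow> nat \<Rightarrow> (nat \<Rightarrow> nat) set" where
  "lattice_simplex r t = {a \<in> {1..r} \<rightarrow>\<^sub>E UNIV. (\<Sum>j=1..r. a j) < t}"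

end

theory Submission
  imports Defs "HOL-Computational_Algebra.Polynomial_FPS"
begin

text \<open>
  Let \<open>I = (F\<^sub>1,\<dots>,F\<^sub>n)\<close> be the ideal of \<open>X\<close>. Since products of linear forms vanishing on \<open>X\<close> separate the
  tangent directions at a point \<open>v\<close> of \<open>X\<close>, the differentials of the \<open>F\<^sub>j\<close> at \<open>v\<close> are independent. So if
  \<open>\<Sum> c\<^sub>a F\<^sup>a\<close>, summed over \<open>|a| = t\<close>, vanishes to order \<open>t + 1\<close> at every point of \<open>X\<close>, then every \<open>c\<^sub>a\<close>
  vanishes on \<open>X\<close>, that is, \<open>c\<^sub>a \<in> I\<close>. This gives two facts at once: the forms that vanish to order
  \<open>t\<close> on \<open>X\<close> lie in \<open>I\<^sup>t\<close>, and \<open>I\<^bsup>t\<^esup>/I\<^bsup>t+1\<^esup>\<close> is free over \<open>R/I\<close> on the monomials of degree \<open>t\<close> in the \<open>F\<^sub>j\<close>.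
  Hence the two sums are the Hilbert functions of the schemes with constant multiplicities \<open>m\<close> and \<open>M\<close>,
  between which \<open>Z\<close> lies. The regular sequence only enters through the Hilbert series
  \<open>\<Prod>(1 - T\<^bsup>d\<^sub>j\<^esup>) / (1 - T)\<^bsup>n+1\<^esup>\<close> of \<open>R/I\<close>, which shows that \<open>H\<^sub>X(i)\<close> is at most \<open>|X|\<close>, with equality
  exactly from \<open>i = \<Sum> d\<^sub>j - n\<close> on. For the regularity index one also needs that \<open>deg Z - H\<^sub>Z(i)\<close> is monotone in
  the multiplicities.
\<close>

(* The simp rule a * (b * x) = (a * b) * x loops with mult.assoc. *)
declare ideal.scale_scale [simp del]

section \<open>Quotients of spaces of forms\<close>

text \<open>The obstacle is to get from vanishing at each point separately to membership in a power
  of I; for complete intersections this usually rests on the unmixedness of I^t. Here it is a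
  computation on lines. For a point v of X, the polynomial F_j(v + T w) is T times a polynomial with
  constant term dF_j(w), so the coefficient of T^t in the sum of the c_a F^a is the sum of the
  c_a(v) y^a, where y_j = dF_j(w). The common kernel of the n differentials contains only multiples
  of v, so they take arbitrary values y on the space of dimension n + 1. A polynomial in y that is
  zero everywhere over a field of characteristic 0 has zero coefficients.

  For the regularity index, inclusions between ideals are not enough, because the degrees to be
  reached differ too. Raising one multiplicity from u to u + 1 raises the degree by the number of
  monomials of degree u in n variables, and the Hilbert function by at most that number. Hence, once
  the Hilbert function has reached the degree, the same holds for all smaller multiplicities on the
  same points.\<close>

abbreviation scal :: "'a::comm_ring_1 \<Rightarrow> ('a, 'v) mpoly \<Rightarrow> ('a, 'v) mpoly" where
  "scal c f \<equiv> Poly_Mapping.single 0 c * f"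

lemma lookup_scal: "Poly_Mapping.lookup (scal c f) e = c * Poly_Mapping.lookup f e"
  by (simp flip: mult_map_scale_conv_mult add: Poly_Mapping.map.rep_eq when_def)

text \<open>The polynomial ring carries two module structures: over itself, for ideals, and this one
  over k, for dimensions.\<close>

global_interpretation mpoly: vector_space
  "scal :: 'a::field \<Rightarrow> ('a, 'v::finite) mpoly \<Rightarrow> ('a, 'v) mpoly"
proof unfold_locales
  fix a b :: 'a and x y :: "('a, 'v) mpoly"
  show "scal a (x + y) = scal a x + scal a y" by (simp add: algebra_simps)
  show "scal (a + b) x = scal a x + scal b x" by (simp add: single_add algebra_simps)
  show "scal a (scal b x) = scal (a * b) x" by (simp flip: mult.assoc add: mult_single)
  show "scal 1 x = x" by simp
qed

lemma ideal_imp_subspace: "ideal.subspace J \<Longrightarrow> mpoly.subspace J"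
  by (simp add: ideal.subspace_def mpoly.subspace_def)

section \<open>Monomials and graded pieces\<close>

definition monomial_degree :: "('v::finite \<Rightarrow>\<^sub>0 nat) \<Rightarrow> nat" where
  "monomial_degree e = (\<Sum>i\<in>UNIV. Poly_Mapping.lookup e i)"

lemma monomial_degree_add: "monomial_degree (e + e') = monomial_degree e + monomial_degree e'"
  by (simp add: monomial_degree_def lookup_add sum.distrib)

lemma forms_iff: "f \<in> forms d \<longleftrightarrow> (\<forall>e. Poly_Mapping.lookup f e \<noteq> 0 \<longrightarrow> monomial_degree e = d)"
  by (auto simp: forms_def monomial_degree_def in_keys_iff)

lemma forms_subspace: "mpoly.subspace (forms d)"
  unfolding mpoly.subspace_def forms_iff mem_Collect_eq Ball_def lookup_add lookup_scal
  by (metis add.right_neutral lookup_zero mult_zero_right)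

lemma single_in_forms: "monomial_degree e = d \<Longrightarrow> Poly_Mapping.single e c \<in> forms d"
  by (auto simp: forms_iff lookup_single when_def split: if_splits)

lemma mult_in_forms:
  fixes f g :: "('a::comm_ring_1, 'v::finite) mpoly"
  assumes "f \<in> forms a" "g \<in> forms b" shows "f * g \<in> forms (a + b)"
  unfolding forms_def
proof (intro CollectI ballI)
  fix e assume "e \<in> Poly_Mapping.keys (f * g)"
  then obtain e1 e2 where "e = e1 + e2" "e1 \<in> Poly_Mapping.keys f" "e2 \<in> Poly_Mapping.keys g"
    using keys_mult[of f g] by blast
  then show "(\<Sum>i\<in>UNIV. Poly_Mapping.lookup e i) = a + b"
    using assms by (simp add: forms_def lookup_add sum.distrib)
qed

lemma one_in_forms: "1 \<in> forms 0"
  by (auto simp: forms_iff lookup_one when_def monomial_degree_def split: if_splits)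

lemma prod_in_forms:
  fixes f :: "'b \<Rightarrow> ('a::comm_ring_1, 'v::finite) mpoly"
  assumes "\<And>i. i \<in> A \<Longrightarrow> f i \<in> forms (d i)"
  shows "(\<Prod>i\<in>A. f i) \<in> forms (\<Sum>i\<in>A. d i)"
  using assms by (induction A rule: infinite_finite_induct) (auto intro: mult_in_forms one_in_forms)

lemma power_in_forms:
  fixes f :: "('a::comm_ring_1, 'v::finite) mpoly"
  shows "f \<in> forms d \<Longrightarrow> f ^ k \<in> forms (k * d)"
  using prod_in_forms[of "{..<k}" "\<lambda>_. f" "\<lambda>_. d"] by simp

lemma finite_monomials: "finite {e :: 'v::finite \<Rightarrow>\<^sub>0 nat. monomial_degree e = d}"
proof (rule finite_imageD)
  have "Poly_Mapping.lookup ` {e :: 'v \<Rightarrow>\<^sub>0 nat. monomial_degree e = d} \<subseteq> Pi\<^sub>E UNIV (\<lambda>_. {..d})"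
    by (auto simp: monomial_degree_def intro: member_le_sum)
  then show "finite (Poly_Mapping.lookup ` {e :: 'v \<Rightarrow>\<^sub>0 nat. monomial_degree e = d})"
    by (rule finite_subset) (intro finite_PiE; simp)
  show "inj_on Poly_Mapping.lookup {e :: 'v \<Rightarrow>\<^sub>0 nat. monomial_degree e = d}"
    by (intro inj_onI) (simp only: poly_mapping_eq_iff)
qed

text \<open>Since \<open>A\<close> may be larger than the support, all monomials of one degree can
  serve as a common index set for the forms of that degree.\<close>

lemma mpoly_eq_sum_monomials:
  fixes f :: "('a::comm_ring_1, 'v::finite) mpoly"
  assumes "finite A" "\<And>e. Poly_Mapping.lookup f e \<noteq> 0 \<Longrightarrow> e \<in> A"
  shows "f = (\<Sum>e\<in>A. scal (Poly_Mapping.lookup f e) (Poly_Mapping.single e 1))"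
proof (rule poly_mapping_eqI)
  fix k
  have "(\<Sum>e\<in>A. Poly_Mapping.lookup (Poly_Mapping.single e (Poly_Mapping.lookup f e)) k) =
    (\<Sum>e\<in>A. if k = e then Poly_Mapping.lookup f e else 0)"
    by (intro sum.cong) (auto simp: lookup_single when_def)
  also have "\<dots> = Poly_Mapping.lookup f k" using assms by auto
  finally show "Poly_Mapping.lookup f k =
      Poly_Mapping.lookup (\<Sum>e\<in>A. scal (Poly_Mapping.lookup f e) (Poly_Mapping.single e 1)) k"
    by (simp add: lookup_sum mult_single)
qed

text \<open>The ring itself is infinite-dimensional; counting is possible only inside a graded
  piece, so later dimension lemmas assume \<open>V \<subseteq> forms d\<close>.\<close>

lemma forms_span_finite:
  "\<exists>T. finite T \<and> forms d \<subseteq> mpoly.span (T :: ('a::field, 'v::finite) mpoly set)"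
proof (intro exI conjI subsetI)
  let ?T = "(\<lambda>e. Poly_Mapping.single e 1) ` {e. monomial_degree e = d} :: ('a, 'v) mpoly set"
  show "finite ?T" by (simp add: finite_monomials)
  fix f :: "('a, 'v) mpoly" assume "f \<in> forms d"
  then have "f = (\<Sum>e\<in>{e. monomial_degree e = d}. scal (Poly_Mapping.lookup f e) (Poly_Mapping.single e 1))"
    by (intro mpoly_eq_sum_monomials) (auto simp: finite_monomials forms_iff)
  also have "\<dots> \<in> mpoly.span ?T"
    by (intro mpoly.span_sum mpoly.span_scale mpoly.span_base) auto
  finally show "f \<in> mpoly.span ?T" .
qed

section \<open>Dimensions of quotients\<close>

lemma finite_basis_in_forms:
  fixes V :: "('a::field, 'v::finite) mpoly set"
  assumes "V \<subseteq> forms d"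
  obtains C where "C \<subseteq> V" "mpoly.independent C" "V \<subseteq> mpoly.span C" "finite C" "card C = mpoly.dim V"
proof -
  obtain C where C: "C \<subseteq> V" "mpoly.independent C" "V \<subseteq> mpoly.span C" "card C = mpoly.dim V"
    using mpoly.basis_exists by blast
  obtain T :: "('a, 'v) mpoly set" where "finite T" "forms d \<subseteq> mpoly.span T"
    using forms_span_finite by blast
  then have "finite C" using mpoly.independent_span_bound[of T C] C(1,2) assms by blast
  with C that show ?thesis by blast
qed

text \<open>Lifts of a basis of the quotient together with a basis of \<open>V \<inter> W\<close>
  form a basis of \<open>V\<close>. So all choices of \<open>B\<close> have the same size, which
  makes the definite description in \<open>quotient_dim\<close> meaningful.\<close>

lemma basis_mod_card:
  fixes V W :: "('a::field, 'v::finite) mpoly set"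
  assumes V: "mpoly.subspace V" "V \<subseteq> forms d" and W: "mpoly.subspace W" and B: "basis_mod V W B"
  shows "card B + mpoly.dim (V \<inter> W) = mpoly.dim V"
proof -
  obtain C where C: "C \<subseteq> V \<inter> W" "mpoly.independent C" "V \<inter> W \<subseteq> mpoly.span C" "finite C"
      "card C = mpoly.dim (V \<inter> W)"
    using finite_basis_in_forms[of "V \<inter> W" d] V(2) by blast
  have fB: "finite B" and BV: "B \<subseteq> V"
    and Bs: "\<And>f. f \<in> V \<Longrightarrow> \<exists>c. f - (\<Sum>b\<in>B. scal (c b) b) \<in> W"
    and Bi: "\<And>c b. (\<Sum>b\<in>B. scal (c b) b) \<in> W \<Longrightarrow> b \<in> B \<Longrightarrow> c b = 0"
    using B by (auto simp: basis_mod_def)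
  \<comment> \<open>A common element would lie in \<open>W\<close> and also be a combination of
    \<open>B\<close> with a coefficient 1.\<close>
  have disj: "B \<inter> C = {}"
  proof (rule ccontr)
    assume "B \<inter> C \<noteq> {}"
    then obtain b where b: "b \<in> B" "b \<in> C" by blast
    have "(\<Sum>x\<in>B. scal (if x = b then 1 else 0) x) = (\<Sum>x\<in>B. if x = b then x else 0)"
      by (intro sum.cong) auto
    also have "\<dots> = b" using fB b by simp
    finally show False using Bi[of "\<lambda>x. if x = b then 1 else 0" b] b C(1) by auto
  qed
  have "mpoly.independent (B \<union> C)"
  proof (rule mpoly.independent_if_scalars_zero)
    fix u x assume u: "(\<Sum>x\<in>B \<union> C. scal (u x) x) = 0" and x: "x \<in> B \<union> C"
    have s: "(\<Sum>x\<in>B. scal (u x) x) + (\<Sum>x\<in>C. scal (u x) x) = 0"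
      using u fB C(4) disj by (simp add: sum.union_disjoint)
    have "(\<Sum>x\<in>C. scal (u x) x) \<in> W"
      using C(1) by (intro mpoly.subspace_sum mpoly.subspace_scale W) auto
    then have "- (\<Sum>x\<in>C. scal (u x) x) \<in> W" by (rule mpoly.subspace_neg[OF W])
    moreover have "(\<Sum>x\<in>B. scal (u x) x) = - (\<Sum>x\<in>C. scal (u x) x)"
      using s by (simp only: eq_neg_iff_add_eq_0)
    ultimately have "(\<Sum>x\<in>B. scal (u x) x) \<in> W" by simp
    then have *: "\<forall>x\<in>B. u x = 0" using Bi by blast
    then have "(\<Sum>x\<in>C. scal (u x) x) = 0" using s by simp
    then have "\<forall>x\<in>C. u x = 0"
      using mpoly.independentD[OF C(2) C(4)] by blast
    with * x show "u x = 0" by blast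
  qed (use fB C in simp)
  moreover have "V \<subseteq> mpoly.span (B \<union> C)"
  proof
    fix f assume f: "f \<in> V"
    obtain c where c: "f - (\<Sum>b\<in>B. scal (c b) b) \<in> W" using Bs[OF f] by blast
    have "(\<Sum>b\<in>B. scal (c b) b) \<in> V"
      using BV by (intro mpoly.subspace_sum mpoly.subspace_scale V) auto
    then have "f - (\<Sum>b\<in>B. scal (c b) b) \<in> mpoly.span C"
      using c f mpoly.subspace_diff[OF V(1)] C(3) by blast
    moreover have "(\<Sum>b\<in>B. scal (c b) b) \<in> mpoly.span B"
      by (intro mpoly.span_sum mpoly.span_scale mpoly.span_base)
    ultimately have "(f - (\<Sum>b\<in>B. scal (c b) b)) + (\<Sum>b\<in>B. scal (c b) b) \<in> mpoly.span (B \<union> C)"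
      using mpoly.span_mono[of C "B \<union> C"] mpoly.span_mono[of B "B \<union> C"] by (intro mpoly.span_add) auto
    then show "f \<in> mpoly.span (B \<union> C)" by simp
  qed
  ultimately have "card (B \<union> C) = mpoly.dim V"
    using BV C(1) by (intro mpoly.basis_card_eq_dim) auto
  then show ?thesis using fB C disj by (simp add: card_Un_disjoint)
qed

text \<open>Extend a basis of \<open>V \<inter> W\<close> to one of \<open>V\<close>; the added
  vectors represent a basis of the quotient.\<close>

lemma basis_mod_exists:
  fixes V W :: "('a::field, 'v::finite) mpoly set"
  assumes V: "mpoly.subspace V" "V \<subseteq> forms d" and W: "mpoly.subspace W"
  shows "\<exists>B. basis_mod V W B"
proof -
  obtain C where C: "C \<subseteq> V \<inter> W" "mpoly.independent C" "V \<inter> W \<subseteq> mpoly.span C" "finite C"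
      "card C = mpoly.dim (V \<inter> W)"
    using finite_basis_in_forms[of "V \<inter> W" d] V(2) by blast
  obtain D where D: "C \<subseteq> D" "D \<subseteq> V" "mpoly.independent D" "V \<subseteq> mpoly.span D"
    using mpoly.maximal_independent_subset_extend[of C V] C by blast
  obtain T :: "('a, 'v) mpoly set" where "finite T" "forms d \<subseteq> mpoly.span T"
    using forms_span_finite by blast
  then have fD: "finite D" using mpoly.independent_span_bound[of T D] D V(2) by blast
  have split: "(\<Sum>x\<in>D. g x) = (\<Sum>x\<in>D - C. g x) + (\<Sum>x\<in>C. g x)" for g :: "_ \<Rightarrow> ('a, 'v) mpoly"
    using sum.subset_diff[OF D(1) fD] .
  have CW: "(\<Sum>x\<in>C. scal (r x) x) \<in> W" for r
    using C(1) by (intro mpoly.subspace_sum mpoly.subspace_scale W) auto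
  have "basis_mod V W (D - C)"
    unfolding basis_mod_def
  proof (intro conjI ballI allI impI)
    show "finite (D - C)" "D - C \<subseteq> V" using fD D by auto
  next
    fix f assume "f \<in> V"
    then obtain r where "f = (\<Sum>x\<in>D. scal (r x) x)"
      using D(4) mpoly.span_finite[OF fD] by fastforce
    then have "f - (\<Sum>x\<in>D - C. scal (r x) x) \<in> W" using CW[of r] split by simp
    then show "\<exists>c. f - (\<Sum>x\<in>D - C. scal (c x) x) \<in> W" by blast
  next
    fix c b assume c: "(\<Sum>b\<in>D - C. scal (c b) b) \<in> W" and b: "b \<in> D - C"
    have "(\<Sum>b\<in>D - C. scal (c b) b) \<in> V"
      using D by (intro mpoly.subspace_sum mpoly.subspace_scale V) auto
    then have "(\<Sum>b\<in>D - C. scal (c b) b) \<in> mpoly.span C" using c C(3) by blast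
    then obtain r where r: "(\<Sum>b\<in>D - C. scal (c b) b) = (\<Sum>x\<in>C. scal (r x) x)"
      using mpoly.span_finite[OF C(4)] by fastforce
    \<comment> \<open>Moving the combination of \<open>C\<close> to the other side gives a linear
      relation on the independent set \<open>D\<close>.\<close>
    define u where "u x = (if x \<in> C then - r x else c x)" for x
    have "(\<Sum>x\<in>D. scal (u x) x) = (\<Sum>b\<in>D - C. scal (c b) b) + (\<Sum>x\<in>C. scal (- r x) x)"
      unfolding split by (simp add: u_def)
    also have "\<dots> = 0" unfolding r by (simp add: single_uminus sum_negf)
    finally have "\<forall>x\<in>D. u x = 0" using mpoly.independentD[OF D(3) fD] by blast
    then show "c b = 0" using b by (auto simp: u_def)
  qed
  then show ?thesis by blast
qed

lemma quotient_dim_basis_mod: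
  fixes V W :: "('a::field, 'v::finite) mpoly set"
  assumes "mpoly.subspace V" "V \<subseteq> forms d" "mpoly.subspace W" "basis_mod V W B"
  shows "quotient_dim V W = card B"
  unfolding quotient_dim_def
proof (rule the_equality)
  fix k assume "\<exists>B'. basis_mod V W B' \<and> card B' = k"
  then obtain B' where "basis_mod V W B'" "card B' = k" by blast
  then show "k = card B" using basis_mod_card[OF assms(1-3), of B'] basis_mod_card[OF assms] by simp
qed (use assms in blast)

lemma quotient_dim_dim:
  fixes V W :: "('a::field, 'v::finite) mpoly set"
  assumes "mpoly.subspace V" "V \<subseteq> forms d" "mpoly.subspace W"
  shows "quotient_dim V W + mpoly.dim (V \<inter> W) = mpoly.dim V"
  using basis_mod_exists[OF assms] basis_mod_card[OF assms] quotient_dim_basis_mod[OF assms] by metis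

lemma quotient_dim_cong:
  fixes V W W' :: "('a::field, 'v::finite) mpoly set"
  assumes "mpoly.subspace V" "V \<subseteq> forms d" "mpoly.subspace W" "mpoly.subspace W'" "V \<inter> W = V \<inter> W'"
  shows "quotient_dim V W = quotient_dim V W'"
  using quotient_dim_dim[of V d W] quotient_dim_dim[of V d W'] assms by simp

text \<open>Additivity of dimension along a chain of subspaces. It is the device by which Hilbert
  functions of nested ideals are computed and compared below.\<close>

lemma quotient_dim_chain:
  fixes V U W :: "('a::field, 'v::finite) mpoly set"
  assumes "mpoly.subspace V" "V \<subseteq> forms d" "mpoly.subspace U" "mpoly.subspace W" "V \<inter> W \<subseteq> U"
  shows "quotient_dim V W = quotient_dim V U + quotient_dim (V \<inter> U) W"
proof -
  have "V \<inter> U \<inter> W = V \<inter> W" using assms by blast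
  then show ?thesis
    using quotient_dim_dim[of V d W] quotient_dim_dim[of V d U] quotient_dim_dim[of "V \<inter> U" d W] assms
      mpoly.subspace_inter[of V U] by fastforce
qed

text \<open>\<open>V\<close> and \<open>V'\<close> may meet \<open>W\<close> in different subspaces,
  so their dimensions cannot be compared directly. Adding \<open>V' \<inter> W\<close> to the
  representatives \<open>B\<close> gives a subspace of \<open>V'\<close> that meets \<open>W\<close>
  exactly as \<open>V'\<close> does.\<close>

lemma quotient_dim_mono:
  fixes V V' W :: "('a::field, 'v::finite) mpoly set"
  assumes "mpoly.subspace V" "mpoly.subspace V'" "V' \<subseteq> forms d" "mpoly.subspace W" "V \<subseteq> V'"
  shows "quotient_dim V W \<le> quotient_dim V' W"
proof -
  have "basis_mod V W B \<Longrightarrow> card B \<le> quotient_dim V' W" for B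
  proof -
    assume B: "basis_mod V W B"
    obtain C where C: "C \<subseteq> V' \<inter> W" "mpoly.independent C" "V' \<inter> W \<subseteq> mpoly.span C" "finite C"
        "card C = mpoly.dim (V' \<inter> W)"
      using finite_basis_in_forms[of "V' \<inter> W" d] assms(3) by blast
    let ?U = "mpoly.span (B \<union> C)"
    have BV: "B \<subseteq> V" "finite B" using B by (auto simp: basis_mod_def)
    have "B \<union> C \<subseteq> V'" using BV C(1) assms by blast
    then have U: "mpoly.subspace ?U" "?U \<subseteq> V'"
      using mpoly.span_minimal assms(2) by (simp, blast)
    have "?U \<inter> W = V' \<inter> W"
      using U(2) C(3) mpoly.span_mono[of C "B \<union> C"] by blast
    moreover have "basis_mod ?U W B"
      unfolding basis_mod_def
    proof (intro conjI ballI)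
      show "finite B" "B \<subseteq> ?U" using BV mpoly.span_superset[of "B \<union> C"] by auto
      show "\<forall>c. (\<Sum>b\<in>B. scal (c b) b) \<in> W \<longrightarrow> (\<forall>b\<in>B. c b = 0)"
        using B by (auto simp: basis_mod_def)
      fix f assume "f \<in> ?U"
      then obtain x y where xy: "f = x + y" "x \<in> mpoly.span B" "y \<in> mpoly.span C"
        by (auto simp: mpoly.span_Un)
      obtain c where "x = (\<Sum>b\<in>B. scal (c b) b)"
        using xy(2) mpoly.span_finite[OF BV(2)] by fastforce
      moreover have "y \<in> W" using xy(3) mpoly.span_minimal[of C W] C(1) assms by blast
      ultimately show "\<exists>c. f - (\<Sum>b\<in>B. scal (c b) b) \<in> W"
        using xy(1) by (intro exI[of _ c]) simp
    qed
    ultimately have 1: "card B + mpoly.dim (V' \<inter> W) = mpoly.dim ?U"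
      using basis_mod_card[of ?U d W B] U assms by auto
    obtain D where D: "D \<subseteq> V'" "mpoly.independent D" "V' \<subseteq> mpoly.span D" "finite D"
      "card D = mpoly.dim V'"
      using finite_basis_in_forms[OF assms(3)] by blast
    have "mpoly.dim ?U \<le> mpoly.dim V'"
      using mpoly.dim_le_card[of ?U D] U D by auto
    then show ?thesis using 1 quotient_dim_dim[OF assms(2-4)] D(5) by linarith
  qed
  then show ?thesis
    using basis_mod_exists[of V d W] quotient_dim_basis_mod[of V d W] assms by (metis order_trans)
qed

text \<open>A family replaces the set of \<open>basis_mod\<close>, because for products such as
  \<open>b * G a\<close> it is not known beforehand that different indices give different elements.
  Independence modulo \<open>W\<close> excludes repetitions.\<close>

lemma quotient_dim_family:
  fixes V W :: "('a::field, 'v::finite) mpoly set"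
  assumes V: "mpoly.subspace V" "V \<subseteq> forms d" and W: "mpoly.subspace W"
    and I: "finite I" "\<And>i. i \<in> I \<Longrightarrow> b i \<in> V"
    and sp: "\<And>f. f \<in> V \<Longrightarrow> \<exists>c. f - (\<Sum>i\<in>I. scal (c i) (b i)) \<in> W"
    and ind: "\<And>c i. (\<Sum>i\<in>I. scal (c i) (b i)) \<in> W \<Longrightarrow> i \<in> I \<Longrightarrow> c i = 0"
  shows "quotient_dim V W = card I"
proof -
  have inj: "inj_on b I"
  proof (rule inj_onI, rule ccontr)
    fix x y assume *: "x \<in> I" "y \<in> I" "b x = b y" "x \<noteq> y"
    define c :: "_ \<Rightarrow> 'a" where "c i = (if i = x then 1 else if i = y then -1 else 0)" for i
    have "(\<Sum>i\<in>I. scal (c i) (b i)) = (\<Sum>i\<in>I. (if i = x then b x else 0) - (if i = y then b y else 0))"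
      using * by (intro sum.cong) (auto simp: c_def single_uminus)
    also have "\<dots> = 0" using * I(1) by (simp add: sum_subtractf)
    finally have "c x = 0" using ind[of c x] * mpoly.subspace_0[OF W] by auto
    then show False by (simp add: c_def)
  qed
  have re: "(\<Sum>x\<in>b ` I. scal (c x) x) = (\<Sum>i\<in>I. scal (c (b i)) (b i))" for c
    using inj by (simp add: sum.reindex)
  have "basis_mod V W (b ` I)"
    unfolding basis_mod_def
  proof (intro conjI ballI allI impI)
    show "finite (b ` I)" "b ` I \<subseteq> V" using I by auto
  next
    fix f assume "f \<in> V"
    then obtain c where c: "f - (\<Sum>i\<in>I. scal (c i) (b i)) \<in> W" using sp by blast
    have "(\<Sum>i\<in>I. scal (c i) (b i)) = (\<Sum>i\<in>I. scal (c (inv_into I b (b i))) (b i))"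
      using inj by (intro sum.cong) auto
    with c show "\<exists>c. f - (\<Sum>x\<in>b ` I. scal (c x) x) \<in> W"
      by (intro exI[of _ "\<lambda>x. c (inv_into I b x)"]) (simp add: re)
  next
    fix c x assume "(\<Sum>x\<in>b ` I. scal (c x) x) \<in> W" "x \<in> b ` I"
    then show "c x = 0" using ind[of "\<lambda>i. c (b i)"] by (auto simp: re)
  qed
  then show ?thesis using quotient_dim_basis_mod[OF V W] inj by (simp add: card_image)
qed

lemma quotient_dim_le_family:
  fixes V W :: "('a::field, 'v::finite) mpoly set"
  assumes V: "mpoly.subspace V" "V \<subseteq> forms d" and W: "mpoly.subspace W" and I: "finite I"
    and V': "\<And>i. i \<in> I \<Longrightarrow> b i \<in> V"
    and sp: "\<And>f. f \<in> V \<Longrightarrow> \<exists>c. f - (\<Sum>i\<in>I. scal (c i) (b i)) \<in> W"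
  shows "quotient_dim V W \<le> card I"
proof -
  obtain C where C: "C \<subseteq> V \<inter> W" "mpoly.independent C" "V \<inter> W \<subseteq> mpoly.span C" "finite C"
      "card C = mpoly.dim (V \<inter> W)"
    using finite_basis_in_forms[of "V \<inter> W" d] V(2) by blast
  have "V \<subseteq> mpoly.span (b ` I \<union> C)"
  proof
    fix f assume f: "f \<in> V"
    obtain c where c: "f - (\<Sum>i\<in>I. scal (c i) (b i)) \<in> W" using sp[OF f] by blast
    have "(\<Sum>i\<in>I. scal (c i) (b i)) \<in> V"
      using V' by (intro mpoly.subspace_sum mpoly.subspace_scale V) auto
    then have "f - (\<Sum>i\<in>I. scal (c i) (b i)) \<in> mpoly.span C"
      using c f mpoly.subspace_diff[OF V(1)] C(3) by blast
    moreover have "(\<Sum>i\<in>I. scal (c i) (b i)) \<in> mpoly.span (b ` I)"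
      by (intro mpoly.span_sum mpoly.span_scale mpoly.span_base) auto
    ultimately have "(f - (\<Sum>i\<in>I. scal (c i) (b i))) + (\<Sum>i\<in>I. scal (c i) (b i)) \<in> mpoly.span (b ` I \<union> C)"
      using mpoly.span_mono[of C "b ` I \<union> C"] mpoly.span_mono[of "b ` I" "b ` I \<union> C"]
      by (intro mpoly.span_add) auto
    then show "f \<in> mpoly.span (b ` I \<union> C)" by simp
  qed
  then have "mpoly.dim V \<le> card (b ` I \<union> C)" using I C by (intro mpoly.dim_le_card) auto
  also have "\<dots> \<le> card I + card C"
    using card_Un_le[of "b ` I" C] card_image_le[OF I, of b] by linarith
  finally show ?thesis using quotient_dim_dim[OF V W] C by simp
qed

section \<open>Homogeneous components and graded quotients\<close>

definition hcomp :: "nat \<Rightarrow> ('a::comm_ring_1, 'v::finite) mpoly \<Rightarrow> ('a, 'v) mpoly" where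
  "hcomp d f = (\<Sum>e\<in>{e \<in> Poly_Mapping.keys f. monomial_degree e = d}.
     Poly_Mapping.single e (Poly_Mapping.lookup f e))"

lemma lookup_hcomp:
  "Poly_Mapping.lookup (hcomp d f) e = (if monomial_degree e = d then Poly_Mapping.lookup f e else 0)"
proof -
  have "Poly_Mapping.lookup (hcomp d f) e =
      (\<Sum>x\<in>{x \<in> Poly_Mapping.keys f. monomial_degree x = d}. if x = e then Poly_Mapping.lookup f e else 0)"
    unfolding hcomp_def lookup_sum by (intro sum.cong) (auto simp: lookup_single when_def)
  then show ?thesis by (auto simp: in_keys_iff)
qed

lemma hcomp_sum: "hcomp d (\<Sum>a\<in>A. f a) = (\<Sum>a\<in>A. hcomp d (f a))"
  by (rule poly_mapping_eqI) (simp add: lookup_hcomp lookup_sum)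

lemma hcomp_in_forms: "hcomp d f \<in> forms d"
  by (auto simp: forms_iff lookup_hcomp split: if_splits)

lemma hcomp_form: "f \<in> forms k \<Longrightarrow> hcomp d f = (if d = k then f else 0)"
  by (auto intro!: poly_mapping_eqI simp: lookup_hcomp forms_iff)

lemma sum_hcomp:
  fixes f :: "('a::comm_ring_1, 'v::finite) mpoly"
  shows "f = (\<Sum>j\<in>monomial_degree ` Poly_Mapping.keys f. hcomp j f)"
  by (rule poly_mapping_eqI) (auto simp: lookup_hcomp lookup_sum in_keys_iff)

text \<open>Multiplication by a form of degree \<open>k\<close> shifts the grading by
  \<open>k\<close>. Below degree \<open>k\<close> the value 0 has to be stated apart, since
  \<open>d - k\<close> truncates there.\<close>

lemma hcomp_mult_form:
  fixes f g :: "('a::comm_ring_1, 'v::finite) mpoly"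
  assumes g: "g \<in> forms k"
  shows "hcomp d (f * g) = (if k \<le> d then hcomp (d - k) f * g else 0)"
proof -
  let ?D = "monomial_degree ` Poly_Mapping.keys f"
  have "hcomp d (f * g) = hcomp d (\<Sum>j\<in>?D. hcomp j f * g)"
    using sum_hcomp[of f] by (metis sum_distrib_right)
  also have "\<dots> = (\<Sum>j\<in>?D. hcomp d (hcomp j f * g))" by (rule hcomp_sum)
  also have "\<dots> = (\<Sum>j\<in>?D. if d = j + k then hcomp j f * g else 0)"
    by (intro sum.cong refl hcomp_form mult_in_forms hcomp_in_forms g)
  also have "\<dots> = (\<Sum>j\<in>?D. if k \<le> d \<and> j = d - k then hcomp j f * g else 0)"
    by (intro sum.cong) auto
  also have "\<dots> = (if k \<le> d then hcomp (d - k) f * g else 0)"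
  proof (cases "k \<le> d \<and> d - k \<notin> ?D")
    case True
    then have "hcomp (d - k) f = 0"
      by (intro poly_mapping_eqI) (force simp: lookup_hcomp in_keys_iff image_iff)
    with True show ?thesis by (auto intro!: sum.neutral)
  qed auto
  finally show ?thesis .
qed

section \<open>Homogeneous generators\<close>

lemma ideal_span_image_finite:
  fixes G :: "'b \<Rightarrow> 'c::comm_ring_1"
  assumes "finite A"
  shows "ideal.span (G ` A) = {\<Sum>a\<in>A. c a * G a | c. True}"
proof (intro equalityI subsetI)
  fix f assume "f \<in> ideal.span (G ` A)"
  then show "f \<in> {\<Sum>a\<in>A. c a * G a | c. True}"
  proof (induction rule: ideal.span_induct_alt)
    case base
    show ?case by (auto intro!: exI[of _ "\<lambda>_. 0"])
  next
    case (step r x y)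
    then obtain a c where a: "a \<in> A" "x = G a" "y = (\<Sum>a\<in>A. c a * G a)" by auto
    have "(\<Sum>b\<in>A. (c b + (if b = a then r else 0)) * G b) =
        (\<Sum>b\<in>A. c b * G b) + (\<Sum>b\<in>A. if b = a then r * G a else 0)"
      unfolding sum.distrib[symmetric] by (intro sum.cong) (auto simp: algebra_simps)
    also have "\<dots> = r * x + y" using a assms by simp
    finally show ?case by (intro CollectI exI[of _ "\<lambda>b. c b + (if b = a then r else 0)"]) simp
  qed
next
  fix f assume "f \<in> {\<Sum>a\<in>A. c a * G a | c. True}"
  then obtain c where "f = (\<Sum>a\<in>A. c a * G a)" by blast
  also have "\<dots> \<in> ideal.span (G ` A)" by (intro ideal.span_sum ideal.span_scale ideal.span_base imageI)
  finally show "f \<in> ideal.span (G ` A)" .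
qed

text \<open>Take the component of degree \<open>i\<close> of any representation. Generators of
  degree above \<open>i\<close> drop out, so that for the remaining ones \<open>i - e a\<close> is a
  true difference.\<close>

lemma homogeneous_representation:
  fixes G :: "'b \<Rightarrow> ('a::comm_ring_1, 'v::finite) mpoly"
  assumes "finite A" "\<And>a. a \<in> A \<Longrightarrow> G a \<in> forms (e a)" "f \<in> forms i" "f \<in> ideal.span (G ` A)"
  obtains c where "f = (\<Sum>a\<in>{a \<in> A. e a \<le> i}. c a * G a)" "\<And>a. c a \<in> forms (i - e a)"
proof -
  obtain c where c: "f = (\<Sum>a\<in>A. c a * G a)"
    using assms(4) ideal_span_image_finite[OF assms(1)] by blast
  have "f = hcomp i f" using assms(3) by (simp add: hcomp_form)
  also have "\<dots> = (\<Sum>a\<in>A. hcomp i (c a * G a))" unfolding c by (rule hcomp_sum)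
  also have "\<dots> = (\<Sum>a\<in>A. if e a \<le> i then hcomp (i - e a) (c a) * G a else 0)"
    using assms(2) by (intro sum.cong refl hcomp_mult_form)
  also have "\<dots> = (\<Sum>a\<in>{a \<in> A. e a \<le> i}. hcomp (i - e a) (c a) * G a)"
    using assms(1) by (simp add: sum.inter_filter)
  finally show thesis using hcomp_in_forms by (intro that)
qed

lemma sum_Sigma_scal:
  fixes G :: "'b \<Rightarrow> ('a::comm_ring_1, 'v::finite) mpoly"
  assumes "finite A" "\<forall>a\<in>A. finite (B a)"
  shows "(\<Sum>p\<in>Sigma A B. scal (k p) (snd p * G (fst p))) = (\<Sum>a\<in>A. (\<Sum>b\<in>B a. scal (k (a, b)) b) * G a)"
proof -
  have "(\<Sum>a\<in>A. (\<Sum>b\<in>B a. scal (k (a, b)) b) * G a) = (\<Sum>a\<in>A. \<Sum>b\<in>B a. scal (k (a, b)) (b * G a))"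
    by (simp only: sum_distrib_right mult.assoc)
  also have "\<dots> = (\<Sum>p\<in>Sigma A B. scal (k p) (snd p * G (fst p)))"
    by (subst sum.Sigma[OF assms]) (simp add: split_def)
  finally show ?thesis by simp
qed

text \<open>The situation here and in the next two lemmas: multiplication by the \<open>G a\<close>
  maps the direct sum of the pieces of R/J in the degrees \<open>e a\<close> onto V/W. The map is
  well defined by \<open>kill\<close> and onto by \<open>rep\<close>; bases of the pieces,
  multiplied by the \<open>G a\<close>, therefore span.\<close>

lemma quotient_dim_graded_spanning:
  fixes V W J :: "('a::field, 'v::finite) mpoly set"
  assumes W: "mpoly.subspace W" and J: "mpoly.subspace J"
    and A: "finite A"
    and rep: "\<And>f. f \<in> V \<Longrightarrow> \<exists>c. (\<forall>a\<in>A. c a \<in> forms (e a)) \<and> f - (\<Sum>a\<in>A. c a * G a) \<in> W"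
    and kill: "\<And>a u. a \<in> A \<Longrightarrow> u \<in> J \<Longrightarrow> u * G a \<in> W"
    and B: "\<And>a. a \<in> A \<Longrightarrow> basis_mod (forms (e a)) J (B a)"
    and f: "f \<in> V"
  shows "\<exists>c. f - (\<Sum>p\<in>Sigma A B. scal (c p) (snd p * G (fst p))) \<in> W"
proof -
  obtain c where c: "\<And>a. a \<in> A \<Longrightarrow> c a \<in> forms (e a)" "f - (\<Sum>a\<in>A. c a * G a) \<in> W"
    using rep[OF f] by blast
  have "\<exists>k. c a - (\<Sum>b\<in>B a. scal (k b) b) \<in> J" if "a \<in> A" for a
    using B[OF that] c(1)[OF that] unfolding basis_mod_def by blast
  then have "\<exists>k. \<forall>a\<in>A. c a - (\<Sum>b\<in>B a. scal (k a b) b) \<in> J" by (intro bchoice ballI)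
  then obtain k where k: "\<And>a. a \<in> A \<Longrightarrow> c a - (\<Sum>b\<in>B a. scal (k a b) b) \<in> J" by blast
  have fin: "\<forall>a\<in>A. finite (B a)" using B by (auto simp: basis_mod_def)
  have "(\<Sum>p\<in>Sigma A B. scal (k (fst p) (snd p)) (snd p * G (fst p))) =
      (\<Sum>a\<in>A. (\<Sum>b\<in>B a. scal (k a b) b) * G a)"
    using sum_Sigma_scal[OF A fin, of "\<lambda>p. k (fst p) (snd p)" G] by simp
  moreover have "(\<Sum>a\<in>A. (c a - (\<Sum>b\<in>B a. scal (k a b) b)) * G a) \<in> W"
    using kill k by (intro mpoly.subspace_sum W) auto
  then have "(f - (\<Sum>a\<in>A. c a * G a)) + (\<Sum>a\<in>A. (c a - (\<Sum>b\<in>B a. scal (k a b) b)) * G a) \<in> W"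
    by (intro mpoly.subspace_add[OF W] c(2))
  ultimately have "f - (\<Sum>p\<in>Sigma A B. scal (k (fst p) (snd p)) (snd p * G (fst p))) \<in> W"
    by (simp add: left_diff_distrib sum_subtractf)
  then show ?thesis by (intro exI[of _ "\<lambda>p. k (fst p) (snd p)"])
qed

lemma quotient_dim_graded_le:
  fixes V W J :: "('a::field, 'v::finite) mpoly set"
  assumes V: "mpoly.subspace V" "V \<subseteq> forms d" and W: "mpoly.subspace W" and J: "mpoly.subspace J"
    and A: "finite A"
    and rep: "\<And>f. f \<in> V \<Longrightarrow> \<exists>c. (\<forall>a\<in>A. c a \<in> forms (e a)) \<and> f - (\<Sum>a\<in>A. c a * G a) \<in> W"
    and kill: "\<And>a u. a \<in> A \<Longrightarrow> u \<in> J \<Longrightarrow> u * G a \<in> W"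
    and mem: "\<And>a u. a \<in> A \<Longrightarrow> u \<in> forms (e a) \<Longrightarrow> u * G a \<in> V"
  shows "quotient_dim V W \<le> (\<Sum>a\<in>A. quotient_dim (forms (e a)) J)"
proof -
  have "\<exists>B. basis_mod (forms (e a)) J B" for a
    using basis_mod_exists forms_subspace J by blast
  then obtain B where B: "\<And>a. basis_mod (forms (e a)) J (B a)" by metis
  have fin: "finite (B a)" "B a \<subseteq> forms (e a)" for a using B by (auto simp: basis_mod_def)
  have "quotient_dim V W \<le> card (Sigma A B)"
  proof (rule quotient_dim_le_family[OF V W])
    fix f assume "f \<in> V"
    then show "\<exists>c. f - (\<Sum>p\<in>Sigma A B. scal (c p) (snd p * G (fst p))) \<in> W"
      by (intro quotient_dim_graded_spanning[OF W J A rep kill B]) auto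
  qed (use A fin mem in \<open>auto dest!: subsetD[OF fin(2)]\<close>)
  also have "\<dots> = (\<Sum>a\<in>A. card (B a))" using A fin by simp
  also have "\<dots> = (\<Sum>a\<in>A. quotient_dim (forms (e a)) J)"
    using quotient_dim_basis_mod[OF forms_subspace subset_refl J B] by simp
  finally show ?thesis .
qed

text \<open>The further condition \<open>inj\<close> says that the map from the sum of the pieces of
  R/J has trivial kernel.\<close>

lemma quotient_dim_graded_eq:
  fixes V W J :: "('a::field, 'v::finite) mpoly set"
  assumes V: "mpoly.subspace V" "V \<subseteq> forms d" and W: "mpoly.subspace W" and J: "mpoly.subspace J"
    and A: "finite A"
    and rep: "\<And>f. f \<in> V \<Longrightarrow> \<exists>c. (\<forall>a\<in>A. c a \<in> forms (e a)) \<and> f - (\<Sum>a\<in>A. c a * G a) \<in> W"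
    and kill: "\<And>a u. a \<in> A \<Longrightarrow> u \<in> J \<Longrightarrow> u * G a \<in> W"
    and mem: "\<And>a u. a \<in> A \<Longrightarrow> u \<in> forms (e a) \<Longrightarrow> u * G a \<in> V"
    and inj: "\<And>c a. (\<And>a. a \<in> A \<Longrightarrow> c a \<in> forms (e a)) \<Longrightarrow> (\<Sum>a\<in>A. c a * G a) \<in> W \<Longrightarrow> a \<in> A \<Longrightarrow> c a \<in> J"
  shows "quotient_dim V W = (\<Sum>a\<in>A. quotient_dim (forms (e a)) J)"
proof -
  have "\<exists>B. basis_mod (forms (e a)) J B" for a
    using basis_mod_exists forms_subspace J by blast
  then obtain B where B: "\<And>a. basis_mod (forms (e a)) J (B a)" by metis
  have fin: "finite (B a)" "B a \<subseteq> forms (e a)" for a using B by (auto simp: basis_mod_def)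
  have "quotient_dim V W = card (Sigma A B)"
  proof (rule quotient_dim_family[OF V W])
    fix f assume "f \<in> V"
    then show "\<exists>c. f - (\<Sum>p\<in>Sigma A B. scal (c p) (snd p * G (fst p))) \<in> W"
      by (intro quotient_dim_graded_spanning[OF W J A rep kill B]) auto
  next
    fix c p assume c: "(\<Sum>p\<in>Sigma A B. scal (c p) (snd p * G (fst p))) \<in> W" and p: "p \<in> Sigma A B"
    have "(\<Sum>p\<in>Sigma A B. scal (c p) (snd p * G (fst p))) =
        (\<Sum>a\<in>A. (\<Sum>b\<in>B a. scal (c (a, b)) b) * G a)"
      using A fin by (intro sum_Sigma_scal) auto
    moreover have "(\<Sum>b\<in>B a. scal (c (a, b)) b) \<in> forms (e a)" for a
      using fin by (intro mpoly.subspace_sum mpoly.subspace_scale forms_subspace) auto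
    ultimately have "(\<Sum>b\<in>B (fst p). scal (c (fst p, b)) b) \<in> J"
      using inj[of "\<lambda>a. \<Sum>b\<in>B a. scal (c (a, b)) b" "fst p"] c p by auto
    then have "\<forall>b\<in>B (fst p). c (fst p, b) = 0"
      using B[of "fst p"] unfolding basis_mod_def by (elim conjE allE[of _ "\<lambda>b. c (fst p, b)"]) blast
    then show "c p = 0" using p by auto
  qed (use A fin mem in \<open>auto dest!: subsetD[OF fin(2)]\<close>)
  also have "\<dots> = (\<Sum>a\<in>A. card (B a))" using A fin by simp
  also have "\<dots> = (\<Sum>a\<in>A. quotient_dim (forms (e a)) J)"
    using quotient_dim_basis_mod[OF forms_subspace subset_refl J B] by simp
  finally show ?thesis .
qed

lemma ideal_span_subspace: "mpoly.subspace (ideal.span S)"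
  by (intro ideal_imp_subspace ideal.subspace_span)

text \<open>Dimension count for the exact sequence 0 -> (R/J)(-d) -> R/J -> R/J' -> 0, whose first
  map is multiplication by the last form, of degree d.\<close>

lemma hilbert_regular_step:
  fixes F :: "nat \<Rightarrow> ('a::field, 'v::finite) mpoly"
  assumes F: "\<And>j. j \<in> {1..Suc r} \<Longrightarrow> F j \<in> forms (d j)"
    and nzd: "\<And>g. F (Suc r) * g \<in> ideal.span (F ` {1..r}) \<Longrightarrow> g \<in> ideal.span (F ` {1..r})"
  shows "hilbert (ideal.span (F ` {1..r})) (int i) =
    hilbert (ideal.span (F ` {1..Suc r})) (int i) + hilbert (ideal.span (F ` {1..r})) (int i - int (d (Suc r)))"
proof -
  let ?J = "ideal.span (F ` {1..r})" and ?J' = "ideal.span (F ` {1..Suc r})"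
  have JJ: "?J \<subseteq> ?J'" by (intro ideal.span_mono) auto
  \<comment> \<open>In degrees below that of the new form, J and J' agree; the empty index set
    matches the value 0 of \<open>hilbert\<close> at negative arguments.\<close>
  define A where "A = (if d (Suc r) \<le> i then {Suc r} else {})"
  have sp: "mpoly.subspace (forms i \<inter> ?J')"
    by (intro mpoly.subspace_inter forms_subspace ideal_span_subspace)
  have "quotient_dim (forms i \<inter> ?J') ?J = (\<Sum>a\<in>A. quotient_dim (forms (i - d a)) ?J)"
  proof (rule quotient_dim_graded_eq[OF sp _ ideal_span_subspace ideal_span_subspace, where G = F])
    fix f assume f: "f \<in> forms i \<inter> ?J'"
    obtain c where c: "f = (\<Sum>a\<in>{a \<in> {1..Suc r}. d a \<le> i}. c a * F a)" "\<And>a. c a \<in> forms (i - d a)"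
      using f homogeneous_representation[of "{1..Suc r}" F d f i] F by auto
    have "{a \<in> {1..Suc r}. d a \<le> i} = {a \<in> {1..r}. d a \<le> i} \<union> A" "{a \<in> {1..r}. d a \<le> i} \<inter> A = {}"
      by (auto simp: A_def le_Suc_eq)
    then have "f - (\<Sum>a\<in>A. c a * F a) = (\<Sum>a\<in>{a \<in> {1..r}. d a \<le> i}. c a * F a)"
      unfolding c(1) by (simp add: sum.union_disjoint A_def)
    also have "\<dots> \<in> ?J" by (intro ideal.span_sum ideal.span_scale ideal.span_base) auto
    finally show "\<exists>c. (\<forall>a\<in>A. c a \<in> forms (i - d a)) \<and> f - (\<Sum>a\<in>A. c a * F a) \<in> ?J"
      using c(2) by blast
  next
    fix a u assume "a \<in> A" "u \<in> ?J"
    then show "u * F a \<in> ?J" using ideal.span_scale[of u _ "F a"] by (simp add: mult.commute)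
  next
    fix a and u :: "('a, 'v) mpoly" assume a: "a \<in> A" "u \<in> forms (i - d a)"
    then have "a = Suc r" "d a \<le> i" by (auto simp: A_def split: if_splits)
    moreover have "u * F (Suc r) \<in> ?J'" by (intro ideal.span_scale ideal.span_base) auto
    ultimately show "u * F a \<in> forms i \<inter> ?J'"
      using mult_in_forms[OF a(2) F[of a]] by auto
  next
    fix c a assume "(\<Sum>a\<in>A. c a * F a) \<in> ?J" "a \<in> A"
    moreover from this have "a = Suc r" "A = {Suc r}" by (auto simp: A_def split: if_splits)
    ultimately have "F (Suc r) * c a \<in> ?J" by (simp add: mult.commute)
    then show "c a \<in> ?J" by (rule nzd)
  qed (auto simp: A_def)
  also have "\<dots> = hilbert ?J (int i - int (d (Suc r)))"
    by (auto simp: A_def hilbert_def nat_diff_distrib)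
  finally have "quotient_dim (forms i \<inter> ?J') ?J = hilbert ?J (int i - int (d (Suc r)))" .
  moreover have "quotient_dim (forms i) ?J = quotient_dim (forms i) ?J' + quotient_dim (forms i \<inter> ?J') ?J"
    using JJ by (intro quotient_dim_chain[of _ i] forms_subspace ideal_span_subspace) auto
  ultimately show ?thesis by (simp add: hilbert_def)
qed

lemma quotient_dim_zero_ideal:
  "quotient_dim (forms i) ({0} :: ('a::field, 'v::finite) mpoly set) = card {e :: 'v \<Rightarrow>\<^sub>0 nat. monomial_degree e = i}"
proof (rule quotient_dim_family[OF forms_subspace subset_refl])
  let ?I = "{e :: 'v \<Rightarrow>\<^sub>0 nat. monomial_degree e = i}"
  fix f :: "('a, 'v) mpoly" assume "f \<in> forms i"
  then have "f = (\<Sum>e\<in>?I. scal (Poly_Mapping.lookup f e) (Poly_Mapping.single e 1))"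
    by (intro mpoly_eq_sum_monomials) (auto simp: finite_monomials forms_iff)
  then have "f - (\<Sum>e\<in>?I. scal (Poly_Mapping.lookup f e) (Poly_Mapping.single e 1)) \<in> {0}"
    unfolding singleton_iff right_minus_eq .
  then show "\<exists>c. f - (\<Sum>e\<in>?I. scal (c e) (Poly_Mapping.single e 1)) \<in> {0}"
    by (rule exI[of _ "Poly_Mapping.lookup f"])
next
  let ?I = "{e :: 'v \<Rightarrow>\<^sub>0 nat. monomial_degree e = i}"
  fix c and k :: "'v \<Rightarrow>\<^sub>0 nat"
  assume c: "(\<Sum>e\<in>?I. scal (c e) (Poly_Mapping.single e (1 :: 'a))) \<in> {0}" and k: "k \<in> ?I"
  have "c k = (\<Sum>e\<in>?I. if e = k then c k else 0)" using k by (simp add: finite_monomials)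
  also have "\<dots> = Poly_Mapping.lookup (\<Sum>e\<in>?I. scal (c e) (Poly_Mapping.single e (1 :: 'a))) k"
    unfolding lookup_sum by (intro sum.cong) (auto simp: mult_single lookup_single when_def)
  finally show "c k = 0" using c by simp
qed (auto simp: finite_monomials single_in_forms mpoly.subspace_0)

section \<open>The Hilbert function of a complete intersection\<close>

lemma monomial_degree_0: "monomial_degree 0 = 0"
  by (simp add: monomial_degree_def)

lemma monomial_degree_single: "monomial_degree (Poly_Mapping.single x k) = k"
  by (simp add: monomial_degree_def lookup_single when_def)

lemma monomial_degree_eq_0_iff: "monomial_degree e = 0 \<longleftrightarrow> e = 0"
  by (auto simp: monomial_degree_def intro!: poly_mapping_eqI)

text \<open>Restricting the variables to a set \<open>A\<close> permits induction on their number,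
  although the type of variables is fixed.\<close>

definition monomials_on :: "'v::finite set \<Rightarrow> nat \<Rightarrow> ('v \<Rightarrow>\<^sub>0 nat) set" where
  "monomials_on A i = {e. Poly_Mapping.keys e \<subseteq> A \<and> monomial_degree e = i}"

lemma finite_monomials_on: "finite (monomials_on A i)"
  by (rule finite_subset[OF _ finite_monomials[of i]]) (auto simp: monomials_on_def)

text \<open>A monomial either avoids \<open>x\<close> or is \<open>x\<close> times a monomial of one
  degree less.\<close>

lemma monomials_on_insert_Suc:
  assumes "x \<notin> A"
  shows "card (monomials_on (insert x A) (Suc i)) = card (monomials_on A (Suc i)) + card (monomials_on (insert x A) i)"
proof -
  let ?g = "\<lambda>e. e + Poly_Mapping.single x (1::nat)"
  have split: "monomials_on (insert x A) (Suc i) = monomials_on A (Suc i) \<union> ?g ` monomials_on (insert x A) i"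
  proof (intro equalityI subsetI)
    fix e assume e: "e \<in> monomials_on (insert x A) (Suc i)"
    show "e \<in> monomials_on A (Suc i) \<union> ?g ` monomials_on (insert x A) i"
    proof (cases "x \<in> Poly_Mapping.keys e")
      case True
      let ?e = "e - Poly_Mapping.single x 1"
      have eq: "e = ?g ?e"
      proof (rule poly_mapping_eqI)
        fix k show "Poly_Mapping.lookup e k = Poly_Mapping.lookup (?g ?e) k"
          using True by (auto simp: lookup_add lookup_minus lookup_single when_def in_keys_iff)
      qed
      have "Poly_Mapping.keys ?e \<subseteq> Poly_Mapping.keys e"
        by (auto simp: in_keys_iff lookup_minus)
      moreover have "monomial_degree ?e + 1 = monomial_degree e"
        using eq monomial_degree_add[of ?e "Poly_Mapping.single x 1"] by (simp add: monomial_degree_single)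
      ultimately have "?e \<in> monomials_on (insert x A) i"
        using e by (auto simp: monomials_on_def)
      then show ?thesis using eq by blast
    next
      case False
      then show ?thesis using e by (auto simp: monomials_on_def)
    qed
  next
    fix e assume "e \<in> monomials_on A (Suc i) \<union> ?g ` monomials_on (insert x A) i"
    then show "e \<in> monomials_on (insert x A) (Suc i)"
    proof
      assume "e \<in> ?g ` monomials_on (insert x A) i"
      then obtain e' where e': "e = ?g e'" "e' \<in> monomials_on (insert x A) i" by blast
      have "Poly_Mapping.keys e \<subseteq> insert x A"
        using e' Poly_Mapping.keys_add[of e' "Poly_Mapping.single x 1"]
        by (auto simp: monomials_on_def)
      then show ?thesis using e'
        by (auto simp: monomials_on_def monomial_degree_add monomial_degree_single)
    qed (auto simp: monomials_on_def)
  qed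
  have "x \<in> Poly_Mapping.keys (?g e)" for e by (simp add: in_keys_iff lookup_add)
  then have "monomials_on A (Suc i) \<inter> ?g ` monomials_on (insert x A) i = {}"
    using assms unfolding monomials_on_def by blast
  moreover have "card (?g ` monomials_on (insert x A) i) = card (monomials_on (insert x A) i)"
    by (intro card_image inj_onI) simp
  ultimately show ?thesis
    unfolding split by (simp add: card_Un_disjoint finite_monomials_on)
qed

lemma monomials_on_0: "monomials_on A 0 = {0}"
  by (auto simp: monomials_on_def monomial_degree_eq_0_iff)

text \<open>The recurrence above says that multiplication by 1 - T removes one variable; without
  variables only the constant monomial is left.\<close>

lemma monomials_on_fps:
  fixes A :: "'v::finite set"
  shows "Abs_fps (\<lambda>i. int (card (monomials_on A i))) * (1 - fps_X) ^ card A = 1"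
proof (induction A rule: finite_induct[OF finite])
  case 1
  have "monomials_on ({} :: 'v set) i = (if i = 0 then {0} else {})" for i
    by (auto simp: monomials_on_def monomial_degree_0)
  then show ?case by (auto intro!: fps_ext)
next
  case (2 x A)
  have "Abs_fps (\<lambda>i. int (card (monomials_on (insert x A) i))) * (1 - fps_X)
      = Abs_fps (\<lambda>i. int (card (monomials_on A i)))" (is "?L = _")
  proof (rule fps_ext)
    fix i show "fps_nth ?L i = fps_nth (Abs_fps (\<lambda>i. int (card (monomials_on A i)))) i"
      using monomials_on_insert_Suc[OF 2(2)]
      by (cases i) (auto simp: right_diff_distrib monomials_on_0)
  qed
  then show ?case using 2 by (simp add: mult.assoc[symmetric])
qed

section \<open>Hilbert series of regular sequences\<close>

definition hilbert_series :: "('a::field, 'v::finite) mpoly set \<Rightarrow> int fps" where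
  "hilbert_series J = Abs_fps (\<lambda>i. int (hilbert J (int i)))"

lemma hilbert_series_zero:
  "hilbert_series ({0} :: ('a::field, 'v::finite) mpoly set) * (1 - fps_X) ^ CARD('v) = 1"
  using monomials_on_fps[of "UNIV :: 'v set"]
  by (simp add: hilbert_series_def hilbert_def quotient_dim_zero_ideal monomials_on_def)

text \<open>The exact sequence of each nonzerodivisor multiplies the series by
  \<open>1 - fps_X ^ d j\<close>.\<close>

lemma hilbert_series_regular:
  fixes F :: "nat \<Rightarrow> ('a::field, 'v::finite) mpoly"
  assumes F: "\<And>j. j \<in> {1..r} \<Longrightarrow> F j \<in> forms (d j)"
    and reg: "\<And>j g. j \<in> {1..r} \<Longrightarrow> F j * g \<in> ideal.span (F ` {1..<j}) \<Longrightarrow> g \<in> ideal.span (F ` {1..<j})"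
  shows "hilbert_series (ideal.span (F ` {1..r})) =
    hilbert_series ({0} :: ('a, 'v) mpoly set) * (\<Prod>j=1..r. 1 - fps_X ^ d j)"
  using assms
proof (induction r)
  case (Suc r)
  let ?J = "ideal.span (F ` {1..r})" and ?J' = "ideal.span (F ` {1..Suc r})"
  have step: "hilbert ?J (int i) = hilbert ?J' (int i) + hilbert ?J (int i - int (d (Suc r)))" for i
    using Suc.prems(2)[of "Suc r"] 
    by (intro hilbert_regular_step Suc.prems(1)) (auto simp: atLeastLessThanSuc_atLeastAtMost)
  have "int (hilbert ?J' (int i)) = int (hilbert ?J (int i)) - int (hilbert ?J (int i - int (d (Suc r))))" for i
    using step[of i] by linarith
  then have "hilbert_series ?J' = hilbert_series ?J * (1 - fps_X ^ d (Suc r))"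
    by (intro fps_ext)
      (auto simp: hilbert_series_def right_diff_distrib fps_X_power_mult_right_nth hilbert_def nat_diff_distrib)
  also have "hilbert_series ?J = hilbert_series ({0} :: ('a, 'v) mpoly set) * (\<Prod>j=1..r. 1 - fps_X ^ d j)"
  proof (rule Suc.IH)
    show "F j \<in> forms (d j)" if "j \<in> {1..r}" for j using Suc.prems(1)[of j] that by simp
    show "g \<in> ideal.span (F ` {1..<j})" if "j \<in> {1..r}" "F j * g \<in> ideal.span (F ` {1..<j})" for j g
      using Suc.prems(2)[of j g] that by simp
  qed
  finally have "hilbert_series ?J' = hilbert_series ({0} :: ('a, 'v) mpoly set) *
      ((\<Prod>j=1..r. 1 - fps_X ^ d j) * (1 - fps_X ^ d (Suc r)))"
    by (simp only: mult.assoc)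
  also have "(\<Prod>j=1..r. 1 - fps_X ^ d j) * (1 - fps_X ^ d (Suc r)) = (\<Prod>j=1..Suc r. 1 - fps_X ^ d j :: int fps)"
    by (simp only: prod.nat_ivl_Suc' le_add1 plus_1_eq_Suc mult.commute)
  finally show ?case .
qed simp

text \<open>The h-polynomial: what is left of the numerator of the Hilbert series after cancelling n
  of the n + 1 factors 1 - T of the denominator.\<close>

definition ci_h_poly :: "nat \<Rightarrow> (nat \<Rightarrow> nat) \<Rightarrow> int poly" where
  "ci_h_poly n d = (\<Prod>j=1..n. \<Sum>k<d j. monom 1 k)"

lemma ci_h_poly_Suc: "ci_h_poly (Suc n) d = ci_h_poly n d * (\<Sum>k<d (Suc n). monom 1 k)"
  by (simp add: ci_h_poly_def)

lemma ci_h_poly_nonneg: "0 \<le> coeff (ci_h_poly n d) k"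
proof (induction n arbitrary: k)
  case 0
  then show ?case by (simp add: ci_h_poly_def)
next
  case (Suc n)
  then show ?case
    unfolding ci_h_poly_Suc coeff_mult
    by (intro sum_nonneg mult_nonneg_nonneg) (auto simp: coeff_sum intro!: sum_nonneg)
qed

lemma degree_sum_monom:
  assumes "0 < m" shows "degree (\<Sum>k<m. monom (1::int) k) = m - 1" "(\<Sum>k<m. monom (1::int) k) \<noteq> 0"
proof -
  have c: "coeff (\<Sum>k<m. monom (1::int) k) i = (if i < m then 1 else 0)" for i
    by (simp add: coeff_sum)
  show "degree (\<Sum>k<m. monom (1::int) k) = m - 1"
    using assms by (intro antisym degree_le le_degree) (auto simp: c)
  show "(\<Sum>k<m. monom (1::int) k) \<noteq> 0" using c[of 0] assms by auto
qed

lemma ci_h_poly_degree: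
  assumes "\<And>j. j \<in> {1..n} \<Longrightarrow> 0 < d j"
  shows "ci_h_poly n d \<noteq> 0" "degree (ci_h_poly n d) = (\<Sum>j=1..n. d j - 1)"
proof -
  show 1: "ci_h_poly n d \<noteq> 0" unfolding ci_h_poly_def using assms degree_sum_monom by auto
  show "degree (ci_h_poly n d) = (\<Sum>j=1..n. d j - 1)"
    unfolding ci_h_poly_def using assms degree_sum_monom
    by (subst degree_prod_eq_sum_degree) auto
qed

lemma ci_h_poly_sum: "(\<Sum>k\<le>degree (ci_h_poly n d). coeff (ci_h_poly n d) k) = int (\<Prod>j=1..n. d j)"
proof -
  have "poly (ci_h_poly n d) 1 = int (\<Prod>j=1..n. d j)"
    by (simp add: ci_h_poly_def poly_prod poly_sum poly_monom)
  then show ?thesis by (simp add: poly_altdef)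
qed

text \<open>The series of R/I is h(T)/(1 - T), and dividing by 1 - T means summing
  coefficients.\<close>

lemma hilbert_ci:
  fixes F :: "nat \<Rightarrow> ('a::field, 'v::finite) mpoly"
  assumes n: "CARD('v) = n + 1"
    and F: "\<And>j. j \<in> {1..n} \<Longrightarrow> F j \<in> forms (d j)" and reg: "regular_sequence n F"
  shows "int (hilbert (ideal.span (F ` {1..n})) (int i)) = (\<Sum>k\<le>i. coeff (ci_h_poly n d) k)"
proof -
  let ?H = "hilbert_series (ideal.span (F ` {1..n}))"
  let ?Z = "hilbert_series ({0} :: ('a, 'v) mpoly set)"
  have "1 - fps_X ^ m = (1 - fps_X) * (\<Sum>k<m. fps_X ^ k :: int fps)" for m
    by (rule one_diff_power_eq)
  then have p: "(\<Prod>j=1..n. 1 - fps_X ^ d j) = (1 - fps_X) ^ n * fps_of_poly (ci_h_poly n d)"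
    by (simp add: prod.distrib ci_h_poly_def fps_of_poly_prod fps_of_poly_sum fps_of_poly_monom')
  have "?H = ?Z * (\<Prod>j=1..n. 1 - fps_X ^ d j)"
    using reg unfolding regular_sequence_def by (intro hilbert_series_regular F) blast+
  then have "?H * (1 - fps_X) ^ (n + 1) = (?Z * (1 - fps_X) ^ (n + 1)) * (\<Prod>j=1..n. 1 - fps_X ^ d j)"
    by (simp only: mult_ac)
  also have "?Z * (1 - fps_X) ^ (n + 1) = 1"
    using hilbert_series_zero[where 'a = 'a and 'v = 'v] unfolding n .
  finally have "?H * (1 - fps_X) ^ (n + 1) = (1 - fps_X) ^ n * fps_of_poly (ci_h_poly n d)"
    unfolding p by (simp only: mult_1_left)
  then have "(1 - fps_X) ^ n * (?H * (1 - fps_X)) = (1 - fps_X) ^ n * fps_of_poly (ci_h_poly n d)"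
    by (simp only: power_add power_one_right mult_ac)
  moreover have "(1 - fps_X :: int fps) \<noteq> 0"
  proof
    assume "(1 - fps_X :: int fps) = 0"
    then have "fps_nth (1 - fps_X :: int fps) 0 = 0" by simp
    then show False by simp
  qed
  ultimately have eq: "?H * (1 - fps_X) = fps_of_poly (ci_h_poly n d)" by simp
  have rec: "fps_nth ?H i - (if i = 0 then 0 else fps_nth ?H (i - 1)) = coeff (ci_h_poly n d) i" for i
    using arg_cong[OF eq, of "\<lambda>f. fps_nth f i"] by (cases i) (auto simp: right_diff_distrib)
  have "fps_nth ?H i = (\<Sum>k\<le>i. coeff (ci_h_poly n d) k)" for i
  proof (induction i)
    case 0
    then show ?case using rec[of 0] by simp
  next
    case (Suc i)
    then show ?case using rec[of "Suc i"] by simp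
  qed
  then show ?thesis by (simp add: hilbert_series_def)
qed

text \<open>Partial sums of nonnegative coefficients grow up to the value of h at 1, which is the
  product of the degrees. The last strict increase comes from the leading coefficient, so the
  threshold is the degree of h, the sum of the d_j - 1.\<close>

lemma hilbert_ci_le:
  fixes F :: "nat \<Rightarrow> ('a::field, 'v::finite) mpoly"
  assumes n: "CARD('v) = n + 1"
    and F: "\<And>j. j \<in> {1..n} \<Longrightarrow> F j \<in> forms (d j)" and reg: "regular_sequence n F"
    and d: "\<And>j. j \<in> {1..n} \<Longrightarrow> 0 < d j"
  shows "hilbert (ideal.span (F ` {1..n})) i \<le> (\<Prod>j=1..n. d j)"
    and "hilbert (ideal.span (F ` {1..n})) i = (\<Prod>j=1..n. d j) \<longleftrightarrow> (\<Sum>j=1..n. int (d j)) - int n \<le> i"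
proof -
  let ?h = "ci_h_poly n d" and ?H = "hilbert (ideal.span (F ` {1..n}))"
  have "0 < (\<Prod>j=1..n. d j)" using d by (simp add: prod_pos)
  have deg: "int (degree ?h) = (\<Sum>j=1..n. int (d j)) - int n"
  proof -
    have "int (degree ?h) = (\<Sum>j=1..n. int (d j) - 1)"
      by (subst ci_h_poly_degree(2)) (use d in \<open>auto simp: of_nat_diff Suc_leI intro!: sum.cong\<close>)
    then show ?thesis by (simp add: sum_subtractf)
  qed
  have "?H i \<le> (\<Prod>j=1..n. d j) \<and> (?H i = (\<Prod>j=1..n. d j) \<longleftrightarrow> int (degree ?h) \<le> i)"
  proof (cases "i < 0")
    case True
    then show ?thesis using \<open>0 < (\<Prod>j=1..n. d j)\<close> by (auto simp: hilbert_def)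
  next
    case False
    then obtain k where k: "i = int k" using nonneg_int_cases by (metis not_less)
    have H: "int (?H i) = (\<Sum>j\<le>k. coeff ?h j)" unfolding k by (rule hilbert_ci[OF n F reg])
    show ?thesis
    proof (cases "degree ?h \<le> k")
      case True
      have "(\<Sum>j\<le>k. coeff ?h j) = (\<Sum>j\<le>degree ?h. coeff ?h j)"
        using True by (intro sum.mono_neutral_right) (auto simp: coeff_eq_0)
      then have "?H i = (\<Prod>j=1..n. d j)" using H ci_h_poly_sum[of n d] by linarith
      then show ?thesis using True k by simp
    next
      case F': False
      have "(\<Sum>j\<le>k. coeff ?h j) < (\<Sum>j\<le>degree ?h. coeff ?h j)"
      proof (rule sum_strict_mono2[of _ _ "degree ?h"])
        have "lead_coeff ?h \<noteq> 0" using ci_h_poly_degree(1)[OF d] by simp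
        then show "0 < coeff ?h (degree ?h)" using ci_h_poly_nonneg[of n d "degree ?h"] by linarith
      qed (use F' ci_h_poly_nonneg in auto)
      then have "?H i < (\<Prod>j=1..n. d j)" using H ci_h_poly_sum[of n d] by linarith
      then show ?thesis using F' k by auto
    qed
  qed
  then show "?H i \<le> (\<Prod>j=1..n. d j)" "?H i = (\<Prod>j=1..n. d j) \<longleftrightarrow> (\<Sum>j=1..n. int (d j)) - int n \<le> i"
    unfolding deg by auto
qed

section \<open>Powers of an ideal\<close>

text \<open>The layers of \<open>lattice_simplex\<close>: a shell indexes the generators of
  I^t/I^(t+1), the simplex all layers before I^t.\<close>

definition shell :: "nat \<Rightarrow> nat \<Rightarrow> (nat \<Rightarrow> nat) set" where
  "shell n t = {a \<in> {1..n} \<rightarrow>\<^sub>E UNIV. (\<Sum>j=1..n. a j) = t}"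

lemma finite_lattice_simplex: "finite (lattice_simplex n t)"
proof (rule finite_subset)
  show "lattice_simplex n t \<subseteq> {1..n} \<rightarrow>\<^sub>E {..t}"
  proof
    fix a assume a: "a \<in> lattice_simplex n t"
    have "a j \<le> t" if "j \<in> {1..n}" for j
      using a member_le_sum[OF that, of a] by (auto simp: lattice_simplex_def)
    with a show "a \<in> {1..n} \<rightarrow>\<^sub>E {..t}" by (auto simp: lattice_simplex_def PiE_iff)
  qed
qed (intro finite_PiE; simp)

lemma lattice_simplex_Suc: "lattice_simplex n (Suc t) = lattice_simplex n t \<union> shell n t"
  by (auto simp: lattice_simplex_def shell_def)

lemma lattice_simplex_shell_disjoint: "lattice_simplex n t \<inter> shell n t = {}"
  by (auto simp: lattice_simplex_def shell_def)

lemma finite_shell: "finite (shell n t)"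
  using finite_lattice_simplex[of n "Suc t"] by (simp add: lattice_simplex_Suc)

lemma lattice_simplex_0: "lattice_simplex n 0 = {}"
  by (simp add: lattice_simplex_def)

lemma card_lattice_simplex_Suc_Suc:
  "card (lattice_simplex (Suc n) (Suc t)) = card (lattice_simplex (Suc n) t) + card (lattice_simplex n (Suc t))"
proof -
  let ?N = "Suc n"
  let ?up = "\<lambda>a :: nat \<Rightarrow> nat. a(?N := Suc (a ?N))" and ?ext = "\<lambda>a :: nat \<Rightarrow> nat. a(?N := 0)"
  have S: "(\<Sum>j=1..?N. a j) = (\<Sum>j=1..n. a j) + a ?N" for a :: "nat \<Rightarrow> nat" by simp
  have upd: "(\<Sum>j=1..n. (a(?N := k)) j) = (\<Sum>j=1..n. a j)" for a :: "nat \<Rightarrow> nat" and k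
    by (intro sum.cong) auto
  have split: "lattice_simplex ?N (Suc t) = ?up ` lattice_simplex ?N t \<union> ?ext ` lattice_simplex n (Suc t)"
  proof (intro equalityI subsetI)
    fix a assume a: "a \<in> lattice_simplex ?N (Suc t)"
    show "a \<in> ?up ` lattice_simplex ?N t \<union> ?ext ` lattice_simplex n (Suc t)"
    proof (cases "a ?N")
      case 0
      \<comment> \<open>Tuples are extensional, so dropping the last entry means resetting it to
        \<open>undefined\<close>.\<close>
      have "a = ?ext (a(?N := undefined))" using 0 by auto
      moreover have "a(?N := undefined) \<in> lattice_simplex n (Suc t)"
        using a unfolding lattice_simplex_def mem_Collect_eq S upd
        by (auto simp: PiE_iff extensional_def)
      ultimately show ?thesis by blast
    next
      case (Suc k)
      have "a = ?up (a(?N := k))" using Suc by auto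
      moreover have "a(?N := k) \<in> lattice_simplex ?N t"
        using a Suc unfolding lattice_simplex_def mem_Collect_eq S upd
        by (auto simp: PiE_iff extensional_def)
      ultimately show ?thesis by blast
    qed
  next
    fix a assume "a \<in> ?up ` lattice_simplex ?N t \<union> ?ext ` lattice_simplex n (Suc t)"
    then show "a \<in> lattice_simplex ?N (Suc t)"
    proof (elim UnE imageE)
      fix b assume "a = ?up b" "b \<in> lattice_simplex ?N t"
      then show ?thesis unfolding lattice_simplex_def mem_Collect_eq S
        by (auto simp: upd PiE_iff extensional_def simp del: sum.cl_ivl_Suc)
    next
      fix b assume "a = ?ext b" "b \<in> lattice_simplex n (Suc t)"
      then show ?thesis unfolding lattice_simplex_def mem_Collect_eq S
        by (auto simp: upd PiE_iff extensional_def simp del: sum.cl_ivl_Suc)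
    qed
  qed
  have "?up ` lattice_simplex ?N t \<inter> ?ext ` lattice_simplex n (Suc t) = {}"
    by (auto dest!: fun_cong[of _ _ ?N])
  moreover have "inj_on ?up A" for A
  proof (rule inj_onI)
    fix a b assume "?up a = ?up b"
    then have "?up a j = ?up b j" for j by simp
    then show "a = b" by (intro ext) (metis fun_upd_other fun_upd_same nat.inject)
  qed
  moreover have "inj_on ?ext (lattice_simplex n (Suc t))"
  proof (rule inj_onI)
    fix a b assume *: "a \<in> lattice_simplex n (Suc t)" "b \<in> lattice_simplex n (Suc t)" "?ext a = ?ext b"
    then have "a ?N = b ?N" by (auto simp: lattice_simplex_def PiE_iff extensional_def)
    moreover have "?ext a j = ?ext b j" for j using * by simp
    ultimately show "a = b" by (intro ext) (metis fun_upd_other)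
  qed
  ultimately show ?thesis
    unfolding split by (simp add: card_Un_disjoint finite_lattice_simplex card_image)
qed

lemma card_lattice_simplex_Suc: "card (lattice_simplex n (Suc t)) = (n + t) choose n"
proof (induction "n + t" arbitrary: n t)
  case 0
  then show ?case by (simp add: lattice_simplex_def)
next
  case (Suc k)
  show ?case
  proof (cases n)
    case 0
    then show ?thesis by (simp add: lattice_simplex_def)
  next
    case n: (Suc n')
    show ?thesis
    proof (cases t)
      case 0
      have 1: "card (lattice_simplex n' (Suc t)) = (n' + t) choose n'" using Suc n by (intro Suc.hyps) auto
      then show ?thesis using 0 n card_lattice_simplex_Suc_Suc[of n' t]
        by (simp add: lattice_simplex_0)
    next
      case t: (Suc t')
      have 1: "card (lattice_simplex n' (Suc t)) = (n' + t) choose n'" using Suc n by (intro Suc.hyps) auto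
      have 2: "card (lattice_simplex n (Suc t')) = (n + t') choose n" using Suc n t by (intro Suc.hyps) auto
      show ?thesis using 1 2 n t card_lattice_simplex_Suc_Suc[of n' t] by simp
    qed
  qed
qed

text \<open>Positivity of \<open>n\<close> matters at \<open>t = 0\<close>: the simplex is empty,
  whereas truncation would turn the binomial for \<open>n = 0\<close> into 0 choose 0, which is
  1.\<close>

lemma card_lattice_simplex: "0 < n \<Longrightarrow> card (lattice_simplex n t) = (n + t - 1) choose n"
  by (cases t) (simp_all add: card_lattice_simplex_Suc lattice_simplex_0)

section \<open>Products and powers of ideals\<close>

lemma ideal_power_subspace: "ideal.subspace (ideal_power I t)"
  by (cases t) (simp_all add: ideal_mult_def)

lemma ideal_mult_mono: "I \<subseteq> I' \<Longrightarrow> J \<subseteq> J' \<Longrightarrow> ideal_mult I J \<subseteq> ideal_mult I' J'"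
  unfolding ideal_mult_def by (intro ideal.span_mono) blast

lemma ideal_power_mono: "I \<subseteq> J \<Longrightarrow> ideal_power I t \<subseteq> ideal_power J t"
  by (induction t) (simp_all add: ideal_mult_mono)

lemma ideal_mult_subset: "ideal.subspace J \<Longrightarrow> ideal_mult I J \<subseteq> J"
  unfolding ideal_mult_def by (rule ideal.span_minimal) (auto intro: ideal.subspace_scale)

lemma ideal_power_Suc_subset: "ideal_power I (Suc t) \<subseteq> ideal_power I t"
  by (simp add: ideal_mult_subset ideal_power_subspace)

lemma ideal_power_antimono: "s \<le> t \<Longrightarrow> ideal_power I t \<subseteq> ideal_power I s"
  by (rule lift_Suc_antimono_le[of "ideal_power I"]) (rule ideal_power_Suc_subset)

lemma mult_mem_ideal_mult: "f \<in> I \<Longrightarrow> g \<in> J \<Longrightarrow> f * g \<in> ideal_mult I J"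
  unfolding ideal_mult_def by (intro ideal.span_base) blast

lemma ideal_mult_span:
  fixes S T :: "'c::comm_ring_1 set"
  shows "ideal_mult (ideal.span S) (ideal.span T) = ideal.span {s * t | s t. s \<in> S \<and> t \<in> T}"
proof
  let ?R = "ideal.span {s * t | s t. s \<in> S \<and> t \<in> T}"
  have 1: "s * b \<in> ?R" if "s \<in> S" "b \<in> ideal.span T" for s b
    using that(2)
  proof (induction rule: ideal.span_induct_alt)
    case (step c x y)
    have "s * x \<in> ?R" using that(1) step(1) by (intro ideal.span_base) blast
    then have "c * (s * x) + s * y \<in> ?R" by (rule ideal.span_add[OF ideal.span_scale step(2)])
    then show ?case by (simp only: distrib_left mult.left_commute)
  qed (simp add: ideal.span_zero)
  have "a * b \<in> ?R" if "a \<in> ideal.span S" "b \<in> ideal.span T" for a b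
    using that(1)
  proof (induction rule: ideal.span_induct_alt)
    case (step c x y)
    have "c * (x * b) + y * b \<in> ?R"
      by (rule ideal.span_add[OF ideal.span_scale[OF 1[OF step(1) that(2)]] step(2)])
    then show ?case by (simp only: distrib_right mult.assoc)
  qed (simp add: ideal.span_zero)
  then show "ideal_mult (ideal.span S) (ideal.span T) \<subseteq> ?R"
    unfolding ideal_mult_def by (intro ideal.span_minimal ideal.subspace_span) blast
  show "?R \<subseteq> ideal_mult (ideal.span S) (ideal.span T)"
    unfolding ideal_mult_def by (intro ideal.span_mono) (auto intro: ideal.span_base)
qed

definition power_product :: "nat \<Rightarrow> (nat \<Rightarrow> 'c::comm_ring_1) \<Rightarrow> (nat \<Rightarrow> nat) \<Rightarrow> 'c" where
  "power_product n F a = (\<Prod>j=1..n. F j ^ a j)"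

lemma power_product_upd:
  assumes "j \<in> {1..n}"
  shows "power_product n F (a(j := Suc (a j))) = F j * power_product n F a"
proof -
  have "power_product n F (a(j := Suc (a j))) =
      F j ^ Suc (a j) * (\<Prod>k\<in>{1..n} - {j}. F k ^ a k)"
    unfolding power_product_def using assms by (subst prod.remove[of _ j]) auto
  also have "\<dots> = F j * (F j ^ a j * (\<Prod>k\<in>{1..n} - {j}. F k ^ a k))" by (simp add: mult.assoc)
  also have "\<dots> = F j * power_product n F a"
    unfolding power_product_def using assms by (subst prod.remove[of _ j]) auto
  finally show ?thesis .
qed

lemma sum_upd_Suc:
  fixes a :: "nat \<Rightarrow> nat"
  assumes "j \<in> {1..n}" shows "(\<Sum>k=1..n. (a(j := Suc (a j))) k) = Suc (\<Sum>k=1..n. a k)"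
proof -
  have "(\<Sum>k=1..n. (a(j := Suc (a j))) k) = (\<Sum>k=1..n. a k + (if k = j then 1 else 0))"
    by (intro sum.cong) auto
  also have "\<dots> = Suc (\<Sum>k=1..n. a k)" using assms by (simp add: sum.distrib)
  finally show ?thesis .
qed

lemma ideal_power_span:
  fixes F :: "nat \<Rightarrow> 'c::comm_ring_1"
  shows "ideal_power (ideal.span (F ` {1..n})) t = ideal.span (power_product n F ` shell n t)"
proof (induction t)
  case 0
  have "1 \<in> power_product n F ` shell n 0"
    by (intro image_eqI[of _ _ "\<lambda>j\<in>{1..n}. 0"]) (auto simp: power_product_def shell_def)
  then have "x * 1 \<in> ideal.span (power_product n F ` shell n 0)" for x
    by (intro ideal.span_scale ideal.span_base)
  then show ?case by auto
next
  case (Suc t)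
  have "{s * u | s u. s \<in> F ` {1..n} \<and> u \<in> power_product n F ` shell n t} = power_product n F ` shell n (Suc t)"
  proof (intro equalityI subsetI)
    fix f assume "f \<in> {s * u | s u. s \<in> F ` {1..n} \<and> u \<in> power_product n F ` shell n t}"
    then obtain j a where *: "j \<in> {1..n}" "a \<in> shell n t" "f = F j * power_product n F a" by blast
    have "a(j := Suc (a j)) \<in> shell n (Suc t)"
      using * sum_upd_Suc[OF *(1), of a] unfolding shell_def by (auto simp: PiE_iff extensional_def)
    then show "f \<in> power_product n F ` shell n (Suc t)"
      using power_product_upd[OF *(1), of F a] *(3) by (metis imageI)
  next
    fix f assume "f \<in> power_product n F ` shell n (Suc t)"
    then obtain a where a: "a \<in> shell n (Suc t)" "f = power_product n F a" by blast
    have "(\<Sum>k=1..n. a k) \<noteq> 0" using a by (simp add: shell_def)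
    then obtain j where j: "j \<in> {1..n}" "a j \<noteq> 0" by (meson sum.neutral)
    \<comment> \<open>A product of positive degree contains some factor \<open>F j\<close>; lowering
      that exponent gives the cofactor.\<close>
    define b where "b = a(j := a j - 1)"
    have ab: "a = b(j := Suc (b j))" using j by (auto simp: b_def)
    have "b \<in> shell n t"
      using a(1) sum_upd_Suc[OF j(1), of b] j unfolding shell_def ab[symmetric]
      by (auto simp: PiE_iff extensional_def b_def)
    moreover have "f = F j * power_product n F b"
      using power_product_upd[OF j(1), of F b] a(2) ab by simp
    ultimately show "f \<in> {s * u | s u. s \<in> F ` {1..n} \<and> u \<in> power_product n F ` shell n t}"
      using j(1) by blast
  qed
  then show ?case using Suc by (simp only: ideal_power.simps ideal_mult_span)
qed

section \<open>The associated graded ring of an ideal\<close>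

definition weight :: "nat \<Rightarrow> (nat \<Rightarrow> nat) \<Rightarrow> (nat \<Rightarrow> nat) \<Rightarrow> nat" where
  "weight n d a = (\<Sum>j=1..n. a j * d j)"

lemma power_product_in_forms:
  fixes F :: "nat \<Rightarrow> ('a::comm_ring_1, 'v::finite) mpoly"
  assumes "\<And>j. j \<in> {1..n} \<Longrightarrow> F j \<in> forms (d j)"
  shows "power_product n F a \<in> forms (weight n d a)"
  unfolding power_product_def weight_def by (intro prod_in_forms power_in_forms assms)

lemma ideal_power_homogeneous_representation:
  fixes F :: "nat \<Rightarrow> ('a::comm_ring_1, 'v::finite) mpoly"
  assumes F: "\<And>j. j \<in> {1..n} \<Longrightarrow> F j \<in> forms (d j)"
    and f: "f \<in> forms i" "f \<in> ideal_power (ideal.span (F ` {1..n})) t"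
  obtains c where "f = (\<Sum>a\<in>{a \<in> shell n t. weight n d a \<le> i}. c a * power_product n F a)"
    "\<And>a. c a \<in> forms (i - weight n d a)"
proof -
  have "f \<in> ideal.span (power_product n F ` shell n t)"
    using f(2) unfolding ideal_power_span .
  moreover have G: "power_product n F a \<in> forms (weight n d a)" for a
    by (intro power_product_in_forms F)
  ultimately obtain c where "f = (\<Sum>a\<in>{a \<in> shell n t. weight n d a \<le> i}. c a * power_product n F a)"
    "\<And>a. c a \<in> forms (i - weight n d a)"
    using homogeneous_representation[of "shell n t" "power_product n F" "weight n d" f i,
        OF finite_shell G f(1)] by blast
  then show thesis by (rule that)
qed

lemma power_product_mem_ideal_power:
  assumes "a \<in> shell n t"
  shows "power_product n F a \<in> ideal_power (ideal.span (F ` {1..n})) t"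
  using assms unfolding ideal_power_span by (intro ideal.span_base imageI)

definition quasi_regular :: "nat \<Rightarrow> (nat \<Rightarrow> ('a::comm_ring_1, 'v::finite) mpoly) \<Rightarrow> bool" where
  "quasi_regular n F \<longleftrightarrow> (\<forall>t A c e. A \<subseteq> shell n t \<longrightarrow> (\<forall>a\<in>A. c a \<in> forms (e a)) \<longrightarrow>
     (\<Sum>a\<in>A. c a * power_product n F a) \<in> ideal_power (ideal.span (F ` {1..n})) (Suc t) \<longrightarrow>
     (\<forall>a\<in>A. c a \<in> ideal.span (F ` {1..n})))"

text \<open>The products of degree \<open>t\<close> always generate I^t/I^(t+1) over R/I, which
  gives the inequality; quasi-regularity says that they generate it freely. The inequality will
  serve for the ideal of a single point, the equality for the ideal of X.\<close>

lemma quotient_dim_ideal_power: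
  fixes F :: "nat \<Rightarrow> ('a::field, 'v::finite) mpoly"
  assumes F: "\<And>j. j \<in> {1..n} \<Longrightarrow> F j \<in> forms (d j)"
  defines "I \<equiv> ideal.span (F ` {1..n})"
  shows "quotient_dim (forms i \<inter> ideal_power I t) (ideal_power I (Suc t))
      \<le> (\<Sum>a\<in>shell n t. hilbert I (int i - int (weight n d a)))" (is ?le)
    and "quasi_regular n F \<Longrightarrow> quotient_dim (forms i \<inter> ideal_power I t) (ideal_power I (Suc t))
      = (\<Sum>a\<in>shell n t. hilbert I (int i - int (weight n d a)))" (is "_ \<Longrightarrow> ?eq")
proof -
  let ?A = "{a \<in> shell n t. weight n d a \<le> i}"
  let ?V = "forms i \<inter> ideal_power I t" and ?G = "power_product n F"
  have fA: "finite ?A" using finite_shell by simp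
  have V: "mpoly.subspace ?V"
    by (intro mpoly.subspace_inter forms_subspace ideal_imp_subspace ideal_power_subspace)
  have W: "mpoly.subspace (ideal_power I (Suc t))" by (intro ideal_imp_subspace ideal_power_subspace)
  have J: "mpoly.subspace I" unfolding I_def by (rule ideal_span_subspace)
  have rep: "\<exists>c. (\<forall>a\<in>?A. c a \<in> forms (i - weight n d a)) \<and> f - (\<Sum>a\<in>?A. c a * ?G a) \<in> ideal_power I (Suc t)"
    if f: "f \<in> ?V" for f
  proof -
    obtain c where c: "f = (\<Sum>a\<in>?A. c a * ?G a)" "\<And>a. c a \<in> forms (i - weight n d a)"
      using ideal_power_homogeneous_representation[of n F d f i t] F f unfolding I_def by blast
    have "f - (\<Sum>a\<in>?A. c a * ?G a) = 0" using c(1) by simp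
    then show ?thesis using c(2) mpoly.subspace_0[OF W] by (intro exI[of _ c]) simp
  qed
  have G: "?G a \<in> ideal_power I t" if "a \<in> ?A" for a
    unfolding I_def using that by (intro power_product_mem_ideal_power) auto
  have kill: "u * ?G a \<in> ideal_power I (Suc t)" if "a \<in> ?A" "u \<in> I" for a u
    using G[OF that(1)] that(2) by (simp add: mult_mem_ideal_mult)
  have mem: "u * ?G a \<in> ?V" if "a \<in> ?A" "u \<in> forms (i - weight n d a)" for a u
    using mult_in_forms[OF that(2) power_product_in_forms[of n F d a]] F that(1)
      ideal.subspace_scale[OF ideal_power_subspace G[OF that(1)]] by auto
  have sums: "(\<Sum>a\<in>?A. quotient_dim (forms (i - weight n d a)) I)
      = (\<Sum>a\<in>shell n t. hilbert I (int i - int (weight n d a)))"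
    using finite_shell[of n t] by (auto simp: sum.inter_filter hilbert_def nat_diff_distrib intro!: sum.cong)
  show ?le
    unfolding sums[symmetric] by (rule quotient_dim_graded_le[OF V _ W J fA rep kill mem]) auto
  assume q: "quasi_regular n F"
  show ?eq
    unfolding sums[symmetric]
  proof (rule quotient_dim_graded_eq[OF V _ W J fA rep kill mem])
    fix c a assume c: "\<And>a. a \<in> ?A \<Longrightarrow> c a \<in> forms (i - weight n d a)"
      "(\<Sum>a\<in>?A. c a * ?G a) \<in> ideal_power I (Suc t)" "a \<in> ?A"
    show "c a \<in> I"
      using q[unfolded quasi_regular_def, rule_format, of ?A t c "\<lambda>a. i - weight n d a" a] c
      unfolding I_def by blast
  qed auto
qed

lemma hilbert_UNIV: "hilbert (UNIV :: ('a::field, 'v::finite) mpoly set) i = 0"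
  using quotient_dim_dim[of "forms (nat i) :: ('a, 'v) mpoly set" "nat i" UNIV]
  by (simp add: hilbert_def forms_subspace)

text \<open>Filtering R by the powers of I splits the Hilbert function into layers, and the shells
  indexing them pile up to the simplex.\<close>

lemma hilbert_ideal_power:
  fixes F :: "nat \<Rightarrow> ('a::field, 'v::finite) mpoly"
  assumes F: "\<And>j. j \<in> {1..n} \<Longrightarrow> F j \<in> forms (d j)" and q: "quasi_regular n F"
  defines "I \<equiv> ideal.span (F ` {1..n})"
  shows "hilbert (ideal_power I t) (int i) = (\<Sum>a\<in>lattice_simplex n t. hilbert I (int i - int (weight n d a)))"
proof (induction t)
  case 0
  then show ?case by (simp add: hilbert_UNIV lattice_simplex_0)
next
  case (Suc t)
  have "quotient_dim (forms i) (ideal_power I (Suc t)) = quotient_dim (forms i) (ideal_power I t) +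
      quotient_dim (forms i \<inter> ideal_power I t) (ideal_power I (Suc t))"
    using ideal_power_Suc_subset[of I t]
    by (intro quotient_dim_chain[of _ i] forms_subspace ideal_imp_subspace ideal_power_subspace) auto
  also have "quotient_dim (forms i \<inter> ideal_power I t) (ideal_power I (Suc t)) =
      (\<Sum>a\<in>shell n t. hilbert I (int i - int (weight n d a)))"
    unfolding I_def by (intro quotient_dim_ideal_power(2) F q)
  also have "quotient_dim (forms i) (ideal_power I t) = hilbert (ideal_power I t) (int i)"
    by (simp add: hilbert_def)
  also have "hilbert (ideal_power I t) (int i) + (\<Sum>a\<in>shell n t. hilbert I (int i - int (weight n d a))) =
      (\<Sum>a\<in>lattice_simplex n (Suc t). hilbert I (int i - int (weight n d a)))"
    unfolding Suc.IH lattice_simplex_Suc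
    by (intro sum.union_disjoint[symmetric] finite_lattice_simplex finite_shell lattice_simplex_shell_disjoint)
  finally show ?case by (simp add: hilbert_def del: ideal_power.simps)
qed

section \<open>Evaluation and differentials\<close>

text \<open>Two substitutions are needed: evaluation at a point, with the identity on k, and
  restriction to a line, with k embedded as constant polynomials. One argument shows that both are
  ring homomorphisms.\<close>

locale coefficient_hom =
  fixes \<phi> :: "'a::comm_ring_1 \<Rightarrow> 'b::comm_ring_1"
  assumes hom_add: "\<phi> (a + b) = \<phi> a + \<phi> b"
    and hom_mult: "\<phi> (a * b) = \<phi> a * \<phi> b"
    and hom_one: "\<phi> 1 = 1"
begin

lemma hom_zero: "\<phi> 0 = 0"
  using hom_add[of 0 0] by simp

definition insertion :: "('v::finite \<Rightarrow> 'b) \<Rightarrow> ('a, 'v) mpoly \<Rightarrow> 'b" where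
  "insertion x f = (\<Sum>e\<in>Poly_Mapping.keys f. \<phi> (Poly_Mapping.lookup f e) * (\<Prod>i\<in>UNIV. x i ^ Poly_Mapping.lookup e i))"

lemma insertion_superset:
  assumes "finite S" "Poly_Mapping.keys f \<subseteq> S"
  shows "insertion x f = (\<Sum>e\<in>S. \<phi> (Poly_Mapping.lookup f e) * (\<Prod>i\<in>UNIV. x i ^ Poly_Mapping.lookup e i))"
  unfolding insertion_def using assms
  by (intro sum.mono_neutral_left) (auto simp: in_keys_iff hom_zero)

lemma insertion_add: "insertion x (f + g) = insertion x f + insertion x g"
proof -
  let ?S = "Poly_Mapping.keys f \<union> Poly_Mapping.keys g"
  have "insertion x (f + g) = (\<Sum>e\<in>?S. \<phi> (Poly_Mapping.lookup (f + g) e) * (\<Prod>i\<in>UNIV. x i ^ Poly_Mapping.lookup e i))"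
    using Poly_Mapping.keys_add[of f g] by (intro insertion_superset) auto
  also have "\<dots> = insertion x f + insertion x g"
    by (simp add: insertion_superset[of ?S] lookup_add hom_add distrib_right sum.distrib)
  finally show ?thesis .
qed

lemma insertion_zero: "insertion x 0 = 0"
  by (simp add: insertion_def)

lemma insertion_single: "insertion x (Poly_Mapping.single e c) = \<phi> c * (\<Prod>i\<in>UNIV. x i ^ Poly_Mapping.lookup e i)"
  by (subst insertion_superset[of "{e}"]) auto

lemma insertion_one: "insertion x 1 = 1"
  using insertion_single[of x 0 1] by (simp add: hom_one)

lemma insertion_sum: "insertion x (\<Sum>a\<in>A. f a) = (\<Sum>a\<in>A. insertion x (f a))"
  by (induction A rule: infinite_finite_induct) (simp_all add: insertion_add insertion_zero)

lemma insertion_mult: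
  fixes f g :: "('a, 'v::finite) mpoly"
  shows "insertion x (f * g) = insertion x f * insertion x g"
proof -
  let ?s = "\<lambda>f e. Poly_Mapping.single e (Poly_Mapping.lookup f e)"
  have rep: "f = (\<Sum>e\<in>Poly_Mapping.keys f. ?s f e)" for f :: "('a, 'v) mpoly"
    using mpoly_eq_sum_monomials[of "Poly_Mapping.keys f" f] by (simp add: mult_single in_keys_iff)
  have "insertion x (?s f e * ?s g e') = insertion x (?s f e) * insertion x (?s g e')" for e e'
    by (simp add: mult_single insertion_single hom_mult lookup_add power_add prod.distrib mult_ac)
  moreover have "f * g = (\<Sum>e\<in>Poly_Mapping.keys f. \<Sum>e'\<in>Poly_Mapping.keys g. ?s f e * ?s g e')"
    by (subst rep[of f], subst rep[of g]) (rule sum_product)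
  ultimately have "insertion x (f * g) =
      (\<Sum>e\<in>Poly_Mapping.keys f. insertion x (?s f e)) * (\<Sum>e'\<in>Poly_Mapping.keys g. insertion x (?s g e'))"
    by (simp add: insertion_sum sum_product)
  then show ?thesis by (simp flip: insertion_sum rep)
qed

lemma insertion_prod: "insertion x (\<Prod>a\<in>A. f a) = (\<Prod>a\<in>A. insertion x (f a))"
  by (induction A rule: infinite_finite_induct) (simp_all add: insertion_mult insertion_one)

lemma insertion_power: "insertion x (f ^ k) = insertion x f ^ k"
  by (induction k) (simp_all add: insertion_mult insertion_one)

end

interpretation evaluation: coefficient_hom "\<lambda>c :: 'a::comm_ring_1. c"
  by unfold_locales auto

interpretation restriction: coefficient_hom "\<lambda>c :: 'a::comm_ring_1. [:c:]"
  by unfold_locales auto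

lemma eval_mpoly_insertion: "eval_mpoly f v = evaluation.insertion (\<lambda>i. v $ i) f"
  by (simp add: eval_mpoly_def evaluation.insertion_def)

lemmas eval_mpoly_simps =
  evaluation.insertion_add[where x = "\<lambda>i. v $ i" for v, folded eval_mpoly_insertion]
  evaluation.insertion_mult[where x = "\<lambda>i. v $ i" for v, folded eval_mpoly_insertion]
  evaluation.insertion_zero[where x = "\<lambda>i. v $ i" for v, folded eval_mpoly_insertion]
  evaluation.insertion_one[where x = "\<lambda>i. v $ i" for v, folded eval_mpoly_insertion]
  evaluation.insertion_single[where x = "\<lambda>i. v $ i" for v, folded eval_mpoly_insertion]
  evaluation.insertion_sum[where x = "\<lambda>i. v $ i" for v, folded eval_mpoly_insertion]
  evaluation.insertion_prod[where x = "\<lambda>i. v $ i" for v, folded eval_mpoly_insertion]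
  evaluation.insertion_power[where x = "\<lambda>i. v $ i" for v, folded eval_mpoly_insertion]

text \<open>The polynomial \<open>f (v + T w)\<close> in \<open>T\<close>; its linear coefficient is the differential of \<open>f\<close> at \<open>v\<close>.\<close>

definition restrict_line :: "'a ^ 'v \<Rightarrow> 'a ^ 'v \<Rightarrow> ('a::comm_ring_1, 'v::finite) mpoly \<Rightarrow> 'a poly" where
  "restrict_line v w = restriction.insertion (\<lambda>i. [:v $ i, w $ i:])"

lemmas restrict_line_simps =
  restriction.insertion_add[where x = "\<lambda>i. [:v $ i, w $ i:]" for v w, folded restrict_line_def]
  restriction.insertion_mult[where x = "\<lambda>i. [:v $ i, w $ i:]" for v w, folded restrict_line_def]
  restriction.insertion_zero[where x = "\<lambda>i. [:v $ i, w $ i:]" for v w, folded restrict_line_def]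
  restriction.insertion_one[where x = "\<lambda>i. [:v $ i, w $ i:]" for v w, folded restrict_line_def]
  restriction.insertion_single[where x = "\<lambda>i. [:v $ i, w $ i:]" for v w, folded restrict_line_def]
  restriction.insertion_sum[where x = "\<lambda>i. [:v $ i, w $ i:]" for v w, folded restrict_line_def]
  restriction.insertion_prod[where x = "\<lambda>i. [:v $ i, w $ i:]" for v w, folded restrict_line_def]
  restriction.insertion_power[where x = "\<lambda>i. [:v $ i, w $ i:]" for v w, folded restrict_line_def]

lemma coeff_restrict_line_0: "coeff (restrict_line v w f) 0 = eval_mpoly f v"
  by (simp add: restrict_line_def restriction.insertion_def eval_mpoly_def poly_0_coeff_0[symmetric]
      poly_sum poly_prod)

definition differential :: "'a ^ 'v \<Rightarrow> ('a::comm_ring_1, 'v::finite) mpoly \<Rightarrow> 'a ^ 'v \<Rightarrow> 'a" where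
  "differential v f w = coeff (restrict_line v w f) 1"

lemma coeff_mult_1: "coeff (p * q) 1 = coeff p 0 * coeff q 1 + coeff p 1 * coeff q 0"
  by (simp add: coeff_mult numeral_eq_Suc atMost_Suc add.commute)

lemma differential_mult:
  "differential v (f * g) w = eval_mpoly f v * differential v g w + differential v f w * eval_mpoly g v"
  by (simp only: differential_def restrict_line_simps coeff_mult_1 coeff_restrict_line_0)

lemma differential_sum: "differential v (\<Sum>a\<in>A. f a) w = (\<Sum>a\<in>A. differential v (f a) w)"
  by (simp add: differential_def restrict_line_simps coeff_sum)

text \<open>A dependence on the direction \<open>w\<close> that is stable under sums and products:
  fixed constant term, linear next coefficient. Linearity of the differential thus reduces to
  coordinates and constants.\<close>

definition linear_coefficient :: "('a ^ 'v \<Rightarrow> 'a::comm_ring_1 poly) \<Rightarrow> bool" where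
  "linear_coefficient p \<longleftrightarrow> (\<forall>w w'. coeff (p w) 0 = coeff (p w') 0) \<and>
     (\<forall>w w'. coeff (p (w + w')) 1 = coeff (p w) 1 + coeff (p w') 1) \<and>
     (\<forall>c w. coeff (p (c *s w)) 1 = c * coeff (p w) 1)"

lemma linear_coefficient_mult:
  fixes p q :: "'a::comm_ring_1 ^ 'v \<Rightarrow> 'a poly"
  assumes p: "linear_coefficient p" and q: "linear_coefficient q"
  shows "linear_coefficient (\<lambda>w. p w * q w)"
proof -
  have p0: "coeff (p w) 0 = coeff (p 0) 0" and q0: "coeff (q w) 0 = coeff (q 0) 0" for w
    using p q unfolding linear_coefficient_def by blast+
  have p1: "coeff (p (w + w')) 1 = coeff (p w) 1 + coeff (p w') 1" "coeff (p (c *s w)) 1 = c * coeff (p w) 1"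
    and q1: "coeff (q (w + w')) 1 = coeff (q w) 1 + coeff (q w') 1" "coeff (q (c *s w)) 1 = c * coeff (q w) 1" for w w' c
    using p q unfolding linear_coefficient_def by blast+
  show ?thesis
    unfolding linear_coefficient_def
  proof (intro conjI allI)
    fix w w' :: "'a ^ 'v" and c :: 'a
    show "coeff (p w * q w) 0 = coeff (p w' * q w') 0"
      using p0[of w] q0[of w] p0[of w'] q0[of w'] by (simp add: coeff_mult)
    show "coeff (p (w + w') * q (w + w')) 1 = coeff (p w * q w) 1 + coeff (p w' * q w') 1"
      unfolding coeff_mult_1 p1 q1 p0[of w] p0[of w'] p0[of "w + w'"] q0[of w] q0[of w'] q0[of "w + w'"]
      by (simp only: distrib_left distrib_right add_ac)
    show "coeff (p (c *s w) * q (c *s w)) 1 = c * coeff (p w * q w) 1"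
      unfolding coeff_mult_1 p1 q1 p0[of w] p0[of "c *s w"] q0[of w] q0[of "c *s w"]
      by (simp only: distrib_left mult_ac)
  qed
qed

lemma linear_coefficient_const: "linear_coefficient (\<lambda>w. [:c:])"
  by (simp add: linear_coefficient_def)

lemma linear_coefficient_prod:
  "(\<And>a. a \<in> A \<Longrightarrow> linear_coefficient (p a)) \<Longrightarrow> linear_coefficient (\<lambda>w. \<Prod>a\<in>A. p a w)"
  by (induction A rule: infinite_finite_induct)
    (use linear_coefficient_const[of 1] in \<open>auto simp: one_pCons intro: linear_coefficient_mult\<close>)

lemma linear_coefficient_power: "linear_coefficient p \<Longrightarrow> linear_coefficient (\<lambda>w. p w ^ k)"
  using linear_coefficient_prod[of "{..<k}" "\<lambda>_. p"] by simp

lemma linear_coefficient_sum: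
  assumes "\<And>a. a \<in> A \<Longrightarrow> linear_coefficient (p a)"
  shows "linear_coefficient (\<lambda>w. \<Sum>a\<in>A. p a w)"
  unfolding linear_coefficient_def coeff_sum sum.distrib[symmetric] sum_distrib_left
  using assms by (intro conjI allI sum.cong refl) (auto simp: linear_coefficient_def)

lemma linear_coefficient_restrict_line: "linear_coefficient (\<lambda>w. restrict_line v w f)"
  unfolding restrict_line_def restriction.insertion_def
  by (intro linear_coefficient_sum linear_coefficient_mult linear_coefficient_const linear_coefficient_prod
      linear_coefficient_power) (simp add: linear_coefficient_def)

lemma differential_linear:
  "differential v f (w + w') = differential v f w + differential v f w'"
  "differential v f (c *s w) = c * differential v f w"
  using linear_coefficient_restrict_line[of v f] by (auto simp: linear_coefficient_def differential_def)

section \<open>Coordinates and homogeneity\<close>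

definition var :: "'v::finite \<Rightarrow> ('a::comm_ring_1, 'v) mpoly" where
  "var i = Poly_Mapping.single (Poly_Mapping.single i 1) 1"

lemma var_in_forms: "var i \<in> forms 1"
  unfolding var_def by (intro single_in_forms) (simp add: monomial_degree_single)

lemma prod_power_single:
  "(\<Prod>j\<in>UNIV. x j ^ Poly_Mapping.lookup (Poly_Mapping.single i 1) j) = (x i :: 'b::comm_ring_1)" for i :: "'v::finite"
proof -
  have "(\<Prod>j\<in>UNIV. x j ^ Poly_Mapping.lookup (Poly_Mapping.single i 1) j) = (\<Prod>j\<in>UNIV. if j = i then x i else 1)"
    by (intro prod.cong) (auto simp: lookup_single when_def)
  then show ?thesis by simp
qed

lemma eval_var: "eval_mpoly (var i) v = v $ i"
  by (simp only: var_def eval_mpoly_simps prod_power_single mult_1)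

lemma restrict_line_var: "restrict_line v w (var i) = [:v $ i, w $ i:]"
  by (simp only: var_def restrict_line_simps prod_power_single) simp

lemma eval_scal: "eval_mpoly (scal c f) v = c * eval_mpoly f v"
  by (simp add: eval_mpoly_simps)

lemma eval_diff: "eval_mpoly (f - g) v = eval_mpoly f v - eval_mpoly g v"
  using eval_mpoly_simps(1)[of "f - g" g v] by (simp add: algebra_simps)

lemma restrict_line_scal: "restrict_line v w (scal c f) = smult c (restrict_line v w f)"
  by (simp add: restrict_line_simps)

lemma restrict_line_diff: "restrict_line v w (f - g) = restrict_line v w f - restrict_line v w g"
  using restrict_line_simps(1)[of v w "f - g" g] by (simp add: algebra_simps)

lemma eval_form_scale:
  assumes "f \<in> forms d"
  shows "eval_mpoly f (c *s v) = c ^ d * eval_mpoly f v"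
proof -
  have "(\<Prod>i\<in>UNIV. (c *s v) $ i ^ Poly_Mapping.lookup e i) = c ^ d * (\<Prod>i\<in>UNIV. v $ i ^ Poly_Mapping.lookup e i)"
    if "e \<in> Poly_Mapping.keys f" for e
    using that assms by (auto simp: power_mult_distrib prod.distrib forms_def power_sum[symmetric])
  then show ?thesis
    unfolding eval_mpoly_def sum_distrib_left by (intro sum.cong) (auto simp: mult_ac)
qed

section \<open>Vanishing at points\<close>

lemma vanishing_ideal_eval:
  assumes "f \<in> vanishing_ideal X" "P \<in> X" "v \<in> P"
  shows "eval_mpoly f v = 0"
  using assms(1) unfolding vanishing_ideal_def
  by (induction rule: ideal.span_induct_alt) (use assms(2,3) in \<open>auto simp: eval_mpoly_simps\<close>)

text \<open>By homogeneity, one representative of each point decides.\<close>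

lemma vanishing_ideal_formI:
  assumes "f \<in> forms d" "\<And>P. P \<in> X \<Longrightarrow> \<exists>v. P = vec.span {v} \<and> eval_mpoly f v = 0"
  shows "f \<in> vanishing_ideal X"
  unfolding vanishing_ideal_def
proof (rule ideal.span_base, intro CollectI conjI ballI exI)
  show "f \<in> forms d" by fact
  fix P u assume "P \<in> X" "u \<in> P"
  then obtain v c where "u = c *s v" "eval_mpoly f v = 0"
    using assms(2)[of P] by (auto simp: vec.span_singleton)
  then show "eval_mpoly f u = 0" using eval_form_scale[OF assms(1), of c v] by simp
qed

lemma vanishing_ideal_antimono: "X \<subseteq> Y \<Longrightarrow> vanishing_ideal Y \<subseteq> vanishing_ideal X"
  unfolding vanishing_ideal_def by (intro ideal.span_mono) auto

text \<open>Each of the \<open>t\<close> factors taken from the ideal of \<open>P\<close> is 0 at T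
  = 0 and contributes one factor T.\<close>

lemma restrict_line_vanishing_power:
  assumes "f \<in> ideal_power (vanishing_ideal {P}) t" "v \<in> P"
  shows "monom 1 t dvd restrict_line v w f"
  using assms(1)
proof (induction t arbitrary: f)
  case 0
  then show ?case by (simp add: monom_0 one_pCons[symmetric])
next
  case (Suc t)
  then have "f \<in> ideal.span {a * b | a b. a \<in> vanishing_ideal {P} \<and> b \<in> ideal_power (vanishing_ideal {P}) t}"
    by (simp add: ideal_mult_def)
  then show ?case
  proof (induction rule: ideal.span_induct_alt)
    case (step c x y)
    then obtain a b where ab: "x = a * b" "a \<in> vanishing_ideal {P}" "b \<in> ideal_power (vanishing_ideal {P}) t"
      by blast
    have "coeff (restrict_line v w a) 0 = 0"
      using vanishing_ideal_eval[OF ab(2) _ assms(2)] by (simp add: coeff_restrict_line_0)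
    then have "monom 1 1 dvd restrict_line v w a"
      by (simp add: monom_1_dvd_iff')
    then have "monom 1 1 * monom 1 t dvd restrict_line v w x"
      unfolding ab(1) restrict_line_simps using Suc.IH[OF ab(3)] by (rule mult_dvd_mono)
    then have "monom 1 (Suc t) dvd restrict_line v w x" by (simp add: mult_monom)
    then show ?case using step(2) unfolding restrict_line_simps by (intro dvd_add dvd_mult)
  qed (simp add: restrict_line_simps)
qed

section \<open>Quasi-regularity\<close>

lemma base_expansion_less:
  fixes a :: "nat \<Rightarrow> nat"
  assumes "\<And>j. j \<in> {1..n} \<Longrightarrow> a j < N"
  shows "(\<Sum>j=1..n. a j * N ^ j) < N ^ Suc n \<or> N = 0"
  using assms
proof (induction n)
  case (Suc n)
  show ?case
  proof (cases "N = 0")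
    case False
    have "(\<Sum>j=1..n. a j * N ^ j) < N ^ Suc n" using Suc False by auto
    moreover have "a (Suc n) * N ^ Suc n \<le> (N - 1) * N ^ Suc n"
      using Suc.prems[of "Suc n"] by (intro mult_right_mono) auto
    moreover have "(\<Sum>j=1..Suc n. a j * N ^ j) = (\<Sum>j=1..n. a j * N ^ j) + a (Suc n) * N ^ Suc n" by simp
    ultimately have "(\<Sum>j=1..Suc n. a j * N ^ j) < N ^ Suc n + (N - 1) * N ^ Suc n" by linarith
    also have "\<dots> = N ^ Suc (Suc n)" using False by (cases N) simp_all
    finally show ?thesis by blast
  qed auto
qed auto

lemma base_expansion_inj:
  fixes a b :: "nat \<Rightarrow> nat"
  assumes "\<And>j. j \<in> {1..n} \<Longrightarrow> a j < N" "\<And>j. j \<in> {1..n} \<Longrightarrow> b j < N"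
    and "(\<Sum>j=1..n. a j * N ^ j) = (\<Sum>j=1..n. b j * N ^ j)"
  shows "\<forall>j\<in>{1..n}. a j = b j"
  using assms
proof (induction n)
  case (Suc n)
  let ?p = "N ^ Suc n"
  let ?A = "\<Sum>j=1..n. a j * N ^ j" and ?B = "\<Sum>j=1..n. b j * N ^ j"
  have N: "N \<noteq> 0" using Suc.prems(1)[of 1] by auto
  have lt: "?A < ?p" "?B < ?p"
    using base_expansion_less[of n a N] base_expansion_less[of n b N] Suc.prems N by auto
  have eq: "?A + a (Suc n) * ?p = ?B + b (Suc n) * ?p" using Suc.prems(3) by simp
  have "(?A + a (Suc n) * ?p) div ?p = a (Suc n)" "(?B + b (Suc n) * ?p) div ?p = b (Suc n)"
    using lt N by (simp_all add: div_mult_self3)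
  then have top: "a (Suc n) = b (Suc n)" using eq by metis
  then have "?A = ?B" using eq by simp
  then have "\<forall>j\<in>{1..n}. a j = b j" using Suc.prems by (intro Suc.IH) auto
  then show ?case using top by (auto simp: le_Suc_eq)
qed simp

lemma prod_power_sum: "(\<Prod>j\<in>A. (x :: 'b::comm_monoid_mult) ^ f j) = x ^ (\<Sum>j\<in>A. f j)"
  by (simp add: power_sum)

text \<open>Kronecker substitution \<open>y j = x ^ (N ^ j)\<close> reduces this to one variable.\<close>

lemma power_product_sum_zero:
  fixes c :: "(nat \<Rightarrow> nat) \<Rightarrow> 'a::{idom, ring_char_0}"
  assumes A: "A \<subseteq> shell n t" and z: "\<And>y. (\<Sum>a\<in>A. c a * power_product n y a) = 0" and a: "a \<in> A"
  shows "c a = 0"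
proof -
  \<comment> \<open>Exponents of total degree \<open>t\<close> are digits in base
    \<open>Suc t\<close>, so different tuples receive different powers.\<close>
  define k where "k a = (\<Sum>j=1..n. a j * Suc t ^ j)" for a :: "nat \<Rightarrow> nat"
  have fA: "finite A" using A finite_shell finite_subset by blast
  have "poly (\<Sum>a\<in>A. monom (c a) (k a)) x = 0" for x
  proof -
    have "power_product n (\<lambda>j. x ^ (Suc t ^ j)) a = x ^ k a" for a
      unfolding power_product_def k_def power_mult[symmetric] prod_power_sum by (simp add: mult.commute)
    then show ?thesis using z[of "\<lambda>j. x ^ (Suc t ^ j)"] by (simp add: poly_sum poly_monom)
  qed
  then have "(\<Sum>a\<in>A. monom (c a) (k a)) = 0" using poly_all_0_iff_0 by blast
  then have "0 = coeff (\<Sum>a\<in>A. monom (c a) (k a)) (k a)" by simp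
  also have "\<dots> = (\<Sum>b\<in>A. if b = a then c a else 0)"
    unfolding coeff_sum
  proof (intro sum.cong refl)
    fix b assume b: "b \<in> A"
    have bd: "x j < Suc t" if "x \<in> A" "j \<in> {1..n}" for x j
      using member_le_sum[OF that(2), of x] that(1) A by (auto simp: shell_def)
    have "b = a" if "k b = k a"
    proof -
      have "\<forall>j\<in>{1..n}. b j = a j"
        using that bd[OF b] bd[OF a] unfolding k_def by (intro base_expansion_inj[of n b "Suc t" a]) auto
      moreover have "b \<in> {1..n} \<rightarrow>\<^sub>E UNIV" "a \<in> {1..n} \<rightarrow>\<^sub>E UNIV" using A a b by (auto simp: shell_def)
      ultimately show ?thesis by (auto intro: PiE_ext)
    qed
    then show "coeff (monom (c b) (k b)) (k a) = (if b = a then c a else 0)" by auto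
  qed
  also have "\<dots> = c a" using fA a by simp
  finally show ?thesis by simp
qed

text \<open>With v_i nonzero, the form is a minor v_i x_j - v_j x_i. If these were zero at
  \<open>w\<close> for all j, then \<open>w\<close> would be a multiple of \<open>v\<close>. Being
  linear, the form is its own differential at every point.\<close>

lemma separating_linear_form:
  fixes v w :: "'a::field ^ 'v::finite"
  assumes "v \<noteq> 0" "w \<notin> vec.span {v}"
  obtains l where "l \<in> forms 1" "eval_mpoly l v = 0" "eval_mpoly l w \<noteq> 0"
    "\<And>v' w'. differential v' l w' = eval_mpoly l w'"
proof -
  obtain i where i: "v $ i \<noteq> 0" using assms(1) by (auto simp: vec_eq_iff)
  have "\<exists>j. v $ i * w $ j \<noteq> v $ j * w $ i"
  proof (rule ccontr)
    assume "\<nexists>j. v $ i * w $ j \<noteq> v $ j * w $ i"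
    then have "w = (w $ i / v $ i) *s v" using i by (auto simp: vec_eq_iff field_simps)
    then show False using assms(2) by (metis vec.span_base vec.span_scale singletonI)
  qed
  then obtain j where j: "v $ i * w $ j \<noteq> v $ j * w $ i" by blast
  let ?l = "scal (v $ i) (var j) - scal (v $ j) (var i) :: ('a, 'v) mpoly"
  show thesis
  proof (rule that[of ?l])
    show "?l \<in> forms 1"
      by (intro mpoly.subspace_diff mpoly.subspace_scale forms_subspace var_in_forms)
    show "eval_mpoly ?l v = 0" "eval_mpoly ?l w \<noteq> 0"
      using j by (auto simp: eval_diff eval_scal eval_var)
    show "differential v' ?l w' = eval_mpoly ?l w'" for v' w'
      by (simp add: differential_def restrict_line_diff restrict_line_scal restrict_line_var
          eval_diff eval_scal eval_var)
  qed
qed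

lemma proj_spaceE:
  assumes "P \<in> proj_space" obtains v where "v \<noteq> 0" "P = vec.span {v}"
  using assms unfolding proj_space_def by blast

lemma span_singleton_eq:
  fixes u v :: "'a::field ^ 'v::finite"
  assumes "v \<noteq> 0" "v \<in> vec.span {u}" shows "vec.span {v} = vec.span {u}"
proof -
  obtain c where c: "v = c *s u" using assms(2) by (auto simp: vec.span_singleton)
  then have "c \<noteq> 0" using assms(1) by auto
  then have "u = inverse c *s v" using c by (simp add: vec.scale_scale)
  then have "u \<in> vec.span {v}" by (metis vec.span_base vec.span_scale singletonI)
  then show ?thesis using assms(2) by (intro antisym vec.span_minimal) auto
qed

text \<open>Multiply a linear form through \<open>v\<close> that is nonzero at \<open>w\<close> by
  linear forms through the other points that miss \<open>v\<close>. As the first factor is 0 at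
  \<open>v\<close>, the product rule leaves its derivative times the nonzero values of the
  others.\<close>

lemma vanishing_ideal_separates_tangents:
  fixes X :: "('a::field ^ 'v::finite) set set"
  assumes X: "X \<subseteq> proj_space" "finite X" "vec.span {v} \<in> X" and v: "v \<noteq> 0" and w: "w \<notin> vec.span {v}"
  obtains g where "g \<in> vanishing_ideal X" "differential v g w \<noteq> 0"
proof -
  obtain l where l: "l \<in> forms 1" "eval_mpoly l v = 0" "eval_mpoly l w \<noteq> 0" "differential v l w = eval_mpoly l w"
    using separating_linear_form[OF v w] by metis
  have "\<exists>u h. Q = vec.span {u} \<and> h \<in> forms 1 \<and> eval_mpoly h u = 0 \<and> eval_mpoly h v \<noteq> 0" if Q: "Q \<in> X - {vec.span {v}}" for Q
  proof -
    obtain u where u: "u \<noteq> 0" "Q = vec.span {u}" using Q X(1) by (blast elim: proj_spaceE)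
    then have "v \<notin> vec.span {u}" using span_singleton_eq[OF v, of u] Q by blast
    then show ?thesis using separating_linear_form[OF u(1)] u(2) by metis
  qed
  then have "\<exists>h. \<forall>Q\<in>X - {vec.span {v}}. \<exists>u. Q = vec.span {u} \<and> h Q \<in> forms 1 \<and> eval_mpoly (h Q) u = 0 \<and> eval_mpoly (h Q) v \<noteq> 0"
    by (intro bchoice) blast
  then obtain h where h: "\<And>Q. Q \<in> X - {vec.span {v}} \<Longrightarrow>
      \<exists>u. Q = vec.span {u} \<and> h Q \<in> forms 1 \<and> eval_mpoly (h Q) u = 0 \<and> eval_mpoly (h Q) v \<noteq> 0" by blast
  let ?X = "X - {vec.span {v}}"
  let ?g = "l * (\<Prod>Q\<in>?X. h Q)"
  show thesis
  proof (rule that)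
    show "?g \<in> vanishing_ideal X"
    proof (rule vanishing_ideal_formI)
      show "?g \<in> forms (1 + (\<Sum>Q\<in>?X. 1))"
        using h by (intro mult_in_forms l prod_in_forms) blast
      fix Q assume Q: "Q \<in> X"
      show "\<exists>u. Q = vec.span {u} \<and> eval_mpoly ?g u = 0"
      proof (cases "Q = vec.span {v}")
        case True
        then show ?thesis using l(2) by (auto simp: eval_mpoly_simps)
      next
        case False
        then obtain u where u: "Q = vec.span {u}" "eval_mpoly (h Q) u = 0" using h[of Q] Q by blast
        have "(\<Prod>Q\<in>?X. eval_mpoly (h Q) u) = 0"
          using False Q X(2) u(2) by (intro prod_zero) auto
        then show ?thesis using u by (auto simp: eval_mpoly_simps)
      qed
    qed
    have "(\<Prod>Q\<in>?X. eval_mpoly (h Q) v) \<noteq> 0" using h X(2) by (subst prod_zero_iff) auto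
    then show "differential v ?g w \<noteq> 0"
      using l by (simp add: differential_mult eval_mpoly_simps)
  qed
qed

text \<open>A direction killed by all \<open>F j\<close> is killed by the whole ideal, since the
  \<open>F j\<close> vanish at \<open>v\<close>; by separation of tangents it is a multiple of
  \<open>v\<close>. So n functionals on a space of dimension n + 1 have a common kernel of dimension
  at most 1 and are jointly onto.\<close>

lemma differential_surjective:
  fixes X :: "('a::field ^ 'v::finite) set set" and F :: "nat \<Rightarrow> ('a, 'v) mpoly"
  assumes n: "CARD('v) = n + 1" and X: "X \<subseteq> proj_space" "finite X" "vec.span {v} \<in> X" and v: "v \<noteq> 0"
    and F: "vanishing_ideal X = ideal.span (F ` {1..n})"
  shows "\<exists>w. \<forall>j\<in>{1..n}. differential v (F j) w = y j"
proof -
  obtain i0 where i0: "v $ i0 \<noteq> 0" using v by (auto simp: vec_eq_iff)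
  have "card (UNIV - {i0}) = card {1..n}" using n by simp
  then obtain h where h: "bij_betw h (UNIV - {i0}) {1..n}"
    using finite_same_card_bij[of "UNIV - {i0}" "{1..n}"] by auto
  have kernel: "w \<in> vec.span {v}" if w: "\<And>j. j \<in> {1..n} \<Longrightarrow> differential v (F j) w = 0" for w
  proof (rule ccontr)
    assume "w \<notin> vec.span {v}"
    then obtain g where g: "g \<in> vanishing_ideal X" "differential v g w \<noteq> 0"
      using vanishing_ideal_separates_tangents[OF X v] by blast
    then obtain c where c: "g = (\<Sum>j\<in>{1..n}. c j * F j)"
      unfolding F using ideal_span_image_finite[of "{1..n}" F] by auto
    have "eval_mpoly (F j) v = 0" if "j \<in> {1..n}" for j
    proof (rule vanishing_ideal_eval[OF _ X(3)])
      show "F j \<in> vanishing_ideal X" unfolding F using that by (intro ideal.span_base imageI)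
    qed (simp add: vec.span_base)
    then have "differential v g w = 0"
      unfolding c differential_sum by (intro sum.neutral) (auto simp: differential_mult w)
    then show False using g by blast
  qed
  \<comment> \<open>The spare coordinate \<open>i0\<close>, at which \<open>v\<close> is nonzero,
    detects multiples of \<open>v\<close> and completes the n functionals to an injective
    endomorphism.\<close>
  define T where "T w = (\<chi> i. if i = i0 then w $ i0 else differential v (F (h i)) w)" for w
  have lin: "Vector_Spaces.linear (*s) (*s) T"
    by (unfold_locales) (auto simp: T_def vec_eq_iff differential_linear algebra_simps)
  interpret T: Vector_Spaces.linear "(*s)" "(*s)" T by (rule lin)
  have "w = 0" if "T w = 0" for w
  proof -
    have T0: "T w $ i = 0" for i using that by simp
    have "differential v (F j) w = 0" if j: "j \<in> {1..n}" for j
    proof -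
      have "j \<in> h ` (UNIV - {i0})" using j h by (simp add: bij_betw_def)
      then obtain i where "i \<noteq> i0" "j = h i" by blast
      then show ?thesis using T0[of i] by (simp add: T_def)
    qed
    then obtain c where c: "w = c *s v" using kernel by (auto simp: vec.span_singleton)
    then have "c = 0" using T0[of i0] i0 by (simp add: T_def)
    then show ?thesis using c by simp
  qed
  then have "inj T" by (simp add: T.inj_iff_eq_0)
  then have "surj T" using lin by (intro vec.linear_inj_imp_surj) auto
  obtain w where w: "T w = (\<chi> i. y (h i))" using \<open>surj T\<close> by (metis surj_def)
  show ?thesis
  proof (intro exI[of _ w] ballI)
    fix j assume "j \<in> {1..n}"
    then have "j \<in> h ` (UNIV - {i0})" using h by (simp add: bij_betw_def)
    then obtain i where i: "i \<noteq> i0" "j = h i" by blast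
    have "T w $ i = y (h i)" using w by simp
    then show "differential v (F j) w = y j" using i by (simp add: T_def)
  qed
qed

text \<open>Only the order of vanishing at one point enters, so the lemma serves both for sums in
  I^(t+1) and for forms known merely to vanish to order t + 1 at the points.\<close>

lemma initial_coefficients_vanish:
  fixes X :: "('a::field_char_0 ^ 'v::finite) set set" and F :: "nat \<Rightarrow> ('a, 'v) mpoly"
  assumes n: "CARD('v) = n + 1" and X: "X \<subseteq> proj_space" "finite X" "vec.span {v} \<in> X" and v: "v \<noteq> 0"
    and F: "vanishing_ideal X = ideal.span (F ` {1..n})"
    and A: "A \<subseteq> shell n t"
    and S: "(\<Sum>a\<in>A. c a * power_product n F a) \<in> ideal_power (vanishing_ideal {vec.span {v}}) (Suc t)"
    and a: "a \<in> A"
  shows "eval_mpoly (c a) v = 0"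
proof (rule power_product_sum_zero[OF A _ a])
  fix y
  obtain w where w: "\<And>j. j \<in> {1..n} \<Longrightarrow> differential v (F j) w = y j"
    using differential_surjective[OF n X v F] by blast
  let ?r = "restrict_line v w"
  have "\<exists>q. ?r (F j) = monom 1 1 * q" if "j \<in> {1..n}" for j
  proof -
    have "F j \<in> vanishing_ideal X" unfolding F using that by (intro ideal.span_base imageI)
    then have "eval_mpoly (F j) v = 0" using X(3) by (rule vanishing_ideal_eval) (simp add: vec.span_base)
    then have "monom 1 1 dvd ?r (F j)" by (simp add: monom_1_dvd_iff' coeff_restrict_line_0)
    then show ?thesis by (elim dvdE) blast
  qed
  then have "\<exists>q. \<forall>j\<in>{1..n}. ?r (F j) = monom 1 1 * q j" by (intro bchoice ballI)
  then obtain q where q: "\<And>j. j \<in> {1..n} \<Longrightarrow> ?r (F j) = monom 1 1 * q j" by blast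
  \<comment> \<open>The constant term of F_j(v + T w)/T is the differential in direction
    \<open>w\<close>, hence the prescribed value.\<close>
  have q0: "coeff (q j) 0 = y j" if "j \<in> {1..n}" for j
    using w[OF that] q[OF that] by (simp add: differential_def coeff_monom_mult)
  have pp: "?r (power_product n F a) = monom 1 t * power_product n q a" if "a \<in> A" for a
  proof -
    have "?r (power_product n F a) = (\<Prod>j=1..n. ?r (F j) ^ a j)"
      by (simp add: power_product_def restrict_line_simps)
    also have "\<dots> = (\<Prod>j=1..n. monom 1 1 ^ a j * q j ^ a j)"
      by (intro prod.cong refl) (simp only: q power_mult_distrib)
    also have "\<dots> = monom 1 1 ^ (\<Sum>j=1..n. a j) * power_product n q a"
      by (simp only: prod.distrib prod_power_sum power_product_def)
    also have "(\<Sum>j=1..n. a j) = t" using that A by (auto simp: shell_def)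
    finally show ?thesis by (simp add: monom_power)
  qed
  have "?r (\<Sum>a\<in>A. c a * power_product n F a) = (\<Sum>a\<in>A. ?r (c a) * (monom 1 t * power_product n q a))"
    unfolding restrict_line_simps by (intro sum.cong refl) (simp only: pp)
  also have "\<dots> = monom 1 t * (\<Sum>a\<in>A. ?r (c a) * power_product n q a)"
    by (simp only: sum_distrib_left mult.left_commute)
  finally have "monom 1 (Suc t) dvd monom 1 t * (\<Sum>a\<in>A. ?r (c a) * power_product n q a)"
    using restrict_line_vanishing_power[OF S, of v w] by (simp add: vec.span_base)
  then have "monom 1 t * monom 1 1 dvd monom 1 t * (\<Sum>a\<in>A. ?r (c a) * power_product n q a)"
    by (simp add: mult_monom)
  \<comment> \<open>Cancelling T^t leaves one factor T, so the remaining sum is 0 at T = 0.\<close>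
  then have "monom 1 1 dvd (\<Sum>a\<in>A. ?r (c a) * power_product n q a)"
    by (subst (asm) dvd_mult_cancel_left) (simp add: monom_eq_0_iff)
  then have "coeff (\<Sum>a\<in>A. ?r (c a) * power_product n q a) 0 = 0"
    by (simp add: monom_1_dvd_iff')
  moreover have "coeff (power_product n q a) 0 = power_product n y a" for a
    by (simp add: power_product_def poly_0_coeff_0[symmetric] poly_prod)
      (auto intro!: prod.cong simp: poly_0_coeff_0 q0)
  ultimately show "(\<Sum>a\<in>A. eval_mpoly (c a) v * power_product n y a) = 0"
    by (simp add: coeff_sum coeff_mult coeff_restrict_line_0)
qed

lemma vanishing_ideal_form_pointsI:
  fixes X :: "('a::field ^ 'v::finite) set set"
  assumes "X \<subseteq> proj_space" "f \<in> forms e"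
    and "\<And>v. v \<noteq> 0 \<Longrightarrow> vec.span {v} \<in> X \<Longrightarrow> eval_mpoly f v = 0"
  shows "f \<in> vanishing_ideal X"
  using assms by (intro vanishing_ideal_formI[OF assms(2)]) (metis proj_spaceE subsetD)

text \<open>I^(t+1) lies in the same power of the ideal of every point, so the coefficients vanish
  on all of X; being forms, they lie in I.\<close>

lemma quasi_regular_reduced_points:
  fixes X :: "('a::field_char_0 ^ 'v::finite) set set" and F :: "nat \<Rightarrow> ('a, 'v) mpoly"
  assumes n: "CARD('v) = n + 1" and X: "X \<subseteq> proj_space" "finite X"
    and F: "vanishing_ideal X = ideal.span (F ` {1..n})"
  shows "quasi_regular n F"
  unfolding quasi_regular_def F[symmetric]
proof (intro allI impI ballI)
  fix t A c e a
  assume A: "A \<subseteq> shell n t" and c: "\<forall>a\<in>A. c a \<in> forms (e a)"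
    and S: "(\<Sum>a\<in>A. c a * power_product n F a) \<in> ideal_power (vanishing_ideal X) (Suc t)" and a: "a \<in> A"
  show "c a \<in> vanishing_ideal X"
  proof (rule vanishing_ideal_form_pointsI[OF X(1)])
    fix v :: "'a ^ 'v" assume v: "v \<noteq> 0" "vec.span {v} \<in> X"
    have "vanishing_ideal X \<subseteq> vanishing_ideal {vec.span {v}}"
      using v by (intro vanishing_ideal_antimono) auto
    from ideal_power_mono[OF this] S
    have "(\<Sum>a\<in>A. c a * power_product n F a) \<in> ideal_power (vanishing_ideal {vec.span {v}}) (Suc t)"
      by (rule subsetD)
    then show "eval_mpoly (c a) v = 0"
      by (rule initial_coefficients_vanish[OF n X v(2,1) F A _ a])
  qed (use c a in blast)
qed

text \<open>Vanishing to one order more pushes the coefficients of a representation in I^t into I.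
  For a form \<open>f\<close> they can be chosen as forms, so vanishing on X puts them into I;
  graded pieces are all that the Hilbert function and the initial degree see.\<close>

lemma symbolic_power_eq_power:
  fixes X :: "('a::field_char_0 ^ 'v::finite) set set" and F :: "nat \<Rightarrow> ('a, 'v) mpoly"
  assumes n: "CARD('v) = n + 1" and X: "X \<subseteq> proj_space" "finite X"
    and F: "vanishing_ideal X = ideal.span (F ` {1..n})" "\<And>j. j \<in> {1..n} \<Longrightarrow> F j \<in> forms (d j)"
    and f: "f \<in> forms i" "\<And>P. P \<in> X \<Longrightarrow> f \<in> ideal_power (vanishing_ideal {P}) t"
  shows "f \<in> ideal_power (vanishing_ideal X) t"
  using f(2)
proof (induction t)
  case (Suc t)
  have "f \<in> ideal_power (vanishing_ideal X) t"
    using Suc.prems ideal_power_Suc_subset by (intro Suc.IH) blast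
  then have "f \<in> ideal_power (ideal.span (F ` {1..n})) t" unfolding F(1) .
  then obtain c where c: "f = (\<Sum>a\<in>{a \<in> shell n t. weight n d a \<le> i}. c a * power_product n F a)"
    "\<And>a. c a \<in> forms (i - weight n d a)"
    using ideal_power_homogeneous_representation[of n F d f i t] F(2) f(1) by blast
  let ?A = "{a \<in> shell n t. weight n d a \<le> i}"
  have "c a * power_product n F a \<in> ideal_power (vanishing_ideal X) (Suc t)" if a: "a \<in> ?A" for a
  proof -
    have "c a \<in> vanishing_ideal X"
    proof (rule vanishing_ideal_form_pointsI[OF X(1) c(2)])
      fix v :: "'a ^ 'v" assume v: "v \<noteq> 0" "vec.span {v} \<in> X"
      show "eval_mpoly (c a) v = 0"
        using Suc.prems[OF v(2)] unfolding c(1)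
        by (rule initial_coefficients_vanish[OF n X v(2,1) F(1) _ _ a, rotated]) auto
    qed
    moreover have "power_product n F a \<in> ideal_power (vanishing_ideal X) t"
      unfolding F using a by (intro power_product_mem_ideal_power) auto
    ultimately show ?thesis by (simp add: mult_mem_ideal_mult)
  qed
  then show ?case unfolding c(1) by (intro ideal.subspace_sum ideal_power_subspace)
qed simp

section \<open>Fat points\<close>

lemma ideal_cong_mult:
  fixes a b c d :: "'c::comm_ring_1"
  assumes "a - b \<in> ideal.span S" "c - d \<in> ideal.span S"
  shows "a * c - b * d \<in> ideal.span S"
proof -
  have "c * (a - b) + b * (c - d) \<in> ideal.span S"
    using assms by (intro ideal.span_add[OF ideal.span_scale ideal.span_scale])
  then show ?thesis by (simp add: algebra_simps)
qed

lemma ideal_cong_prod: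
  fixes f g :: "'b \<Rightarrow> 'c::comm_ring_1"
  assumes "\<And>i. i \<in> A \<Longrightarrow> f i - g i \<in> ideal.span S"
  shows "(\<Prod>i\<in>A. f i) - (\<Prod>i\<in>A. g i) \<in> ideal.span S"
  using assms
  by (induction A rule: infinite_finite_induct) (auto intro: ideal_cong_mult ideal.span_zero)

lemma ideal_cong_power:
  fixes a b :: "'c::comm_ring_1"
  shows "a - b \<in> ideal.span S \<Longrightarrow> a ^ k - b ^ k \<in> ideal.span S"
  using ideal_cong_prod[of "{..<k}" "\<lambda>_. a" "\<lambda>_. b" S] by simp

lemma const_mult: "Poly_Mapping.single 0 (a * b) = Poly_Mapping.single 0 a * (Poly_Mapping.single 0 b :: ('a::comm_ring_1, 'v) mpoly)"
  by (simp add: mult_single)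

lemma const_power: "Poly_Mapping.single 0 (c ^ k) = (Poly_Mapping.single 0 c ^ k :: ('a::comm_ring_1, 'v) mpoly)"
  by (induction k) (simp_all add: const_mult)

lemma monomial_eq_prod_var:
  fixes e :: "'v::finite \<Rightarrow>\<^sub>0 nat"
  shows "Poly_Mapping.single e (1 :: 'a::comm_ring_1) = (\<Prod>i\<in>UNIV. var i ^ Poly_Mapping.lookup e i)"
proof -
  have vp: "var i ^ k = Poly_Mapping.single (Poly_Mapping.single i k) (1 :: 'a)" for i :: 'v and k
    by (induction k) (simp_all add: var_def mult_single flip: single_add)
  have "(\<Prod>i\<in>A. Poly_Mapping.single (Poly_Mapping.single i (Poly_Mapping.lookup e i)) (1 :: 'a)) =
      Poly_Mapping.single (\<Sum>i\<in>A. Poly_Mapping.single i (Poly_Mapping.lookup e i)) 1" for A :: "'v set"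
    by (induction A rule: infinite_finite_induct) (simp_all add: mult_single)
  moreover have "(\<Sum>i\<in>UNIV. Poly_Mapping.single i (Poly_Mapping.lookup e i)) = e"
  proof (rule poly_mapping_eqI)
    fix k
    have "(\<Sum>i\<in>UNIV. Poly_Mapping.lookup (Poly_Mapping.single i (Poly_Mapping.lookup e i)) k) =
        (\<Sum>i\<in>UNIV. if i = k then Poly_Mapping.lookup e k else 0)"
      by (intro sum.cong) (auto simp: lookup_single when_def)
    then show "Poly_Mapping.lookup (\<Sum>i\<in>UNIV. Poly_Mapping.single i (Poly_Mapping.lookup e i)) k = Poly_Mapping.lookup e k"
      by (simp add: lookup_sum)
  qed
  ultimately show ?thesis by (simp add: vp)
qed

text \<open>Modulo the relations each variable x_i becomes v_i times the variable \<open>i0\<close>,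
  so a monomial of degree \<open>d\<close> becomes its value at \<open>v\<close> times
  \<open>var i0 ^ d\<close>.\<close>

lemma form_cong_power_var:
  fixes v :: "'a::comm_ring_1 ^ 'v::finite"
  assumes f: "f \<in> forms d" and S: "\<And>i. var i - scal (v $ i) (var i0) \<in> ideal.span S"
  shows "f - scal (eval_mpoly f v) (var i0 ^ d) \<in> ideal.span S"
proof -
  have mono: "Poly_Mapping.single e 1 - scal (\<Prod>i\<in>UNIV. v $ i ^ Poly_Mapping.lookup e i) (var i0 ^ d) \<in> ideal.span S"
    if e: "e \<in> Poly_Mapping.keys f" for e
  proof -
    have "(\<Sum>i\<in>UNIV. Poly_Mapping.lookup e i) = d" using e f by (simp add: forms_def)
    moreover have "(\<Prod>i\<in>A. scal (v $ i) (var i0) ^ Poly_Mapping.lookup e i) =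
        scal (\<Prod>i\<in>A. v $ i ^ Poly_Mapping.lookup e i) (var i0 ^ (\<Sum>i\<in>A. Poly_Mapping.lookup e i))" for A :: "'v set"
      by (induction A rule: infinite_finite_induct)
        (simp_all add: power_mult_distrib power_add const_mult const_power mult_ac)
    ultimately have eq: "(\<Prod>i\<in>UNIV. scal (v $ i) (var i0) ^ Poly_Mapping.lookup e i) =
        scal (\<Prod>i\<in>UNIV. v $ i ^ Poly_Mapping.lookup e i) (var i0 ^ d)" by metis
    show ?thesis
      unfolding monomial_eq_prod_var eq[symmetric] by (intro ideal_cong_prod ideal_cong_power S)
  qed
  let ?K = "Poly_Mapping.keys f"
  have A: "f = (\<Sum>e\<in>?K. scal (Poly_Mapping.lookup f e) (Poly_Mapping.single e 1))"
    by (intro mpoly_eq_sum_monomials) (auto simp: in_keys_iff)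
  have B: "scal (eval_mpoly f v) (var i0 ^ d) =
      (\<Sum>e\<in>?K. scal (Poly_Mapping.lookup f e) (scal (\<Prod>i\<in>UNIV. v $ i ^ Poly_Mapping.lookup e i) (var i0 ^ d)))"
  proof -
    have s: "Poly_Mapping.single 0 (\<Sum>e\<in>A. h e) = (\<Sum>e\<in>A. Poly_Mapping.single 0 (h e))"
      for h :: "('v \<Rightarrow>\<^sub>0 nat) \<Rightarrow> 'a" and A
      by (induction A rule: infinite_finite_induct) (simp_all add: single_add)
    show ?thesis
      unfolding eval_mpoly_def s sum_distrib_right
      by (intro sum.cong refl) (simp only: const_mult mult.assoc)
  qed
  have "f - scal (eval_mpoly f v) (var i0 ^ d) =
      (\<Sum>e\<in>?K. scal (Poly_Mapping.lookup f e)
        (Poly_Mapping.single e 1 - scal (\<Prod>i\<in>UNIV. v $ i ^ Poly_Mapping.lookup e i) (var i0 ^ d)))"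
    unfolding right_diff_distrib sum_subtractf A[symmetric] B[symmetric] ..
  also have "\<dots> \<in> ideal.span S" by (intro ideal.span_sum ideal.span_scale mono)
  finally show ?thesis .
qed

text \<open>Scale a representative to have coordinate 1 at \<open>i0\<close>. The n linear forms
  comparing the other variables with \<open>var i0\<close> generate, and modulo them each degree is
  spanned by a power of \<open>var i0\<close>.\<close>

lemma point_ideal_generators:
  fixes P :: "('a::field ^ 'v::finite) set"
  assumes n: "CARD('v) = n + 1" and P: "P \<in> proj_space"
  obtains G where "\<And>j. j \<in> {1..n} \<Longrightarrow> G j \<in> forms 1" "vanishing_ideal {P} = ideal.span (G ` {1..n})"
    "\<And>i. hilbert (vanishing_ideal {P}) i \<le> 1"
proof -
  obtain u where u: "u \<noteq> 0" "P = vec.span {u}" using P by (rule proj_spaceE)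
  obtain i0 where i0: "u $ i0 \<noteq> 0" using u(1) by (auto simp: vec_eq_iff)
  define v where "v = inverse (u $ i0) *s u"
  have vi0: "v $ i0 = 1" using i0 by (simp add: v_def)
  have Pv: "P = vec.span {v}"
    unfolding u(2) using vi0 by (intro span_singleton_eq[symmetric])
      (auto simp: v_def vec.span_base vec.span_scale)
  have "card {1..n} = card (UNIV - {i0})" using n by simp
  then obtain h where h: "bij_betw h {1..n} (UNIV - {i0})"
    using finite_same_card_bij[of "{1..n}" "UNIV - {i0}"] by auto
  define l where "l i = var i - scal (v $ i) (var i0)" for i
  define G where "G j = l (h j)" for j
  have Gi: "G ` {1..n} = l ` (UNIV - {i0})"
    using h unfolding G_def bij_betw_def by (metis image_image)
  \<comment> \<open>For \<open>i0\<close> itself the form is 0 because of the scaling, so the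
    reduction can treat all variables alike.\<close>
  have l_span: "l i \<in> ideal.span (G ` {1..n})" for i
  proof (cases "i = i0")
    case True
    then have "l i = 0" using vi0 by (simp add: l_def)
    then show ?thesis by (simp add: ideal.span_zero)
  next
    case False
    then show ?thesis unfolding Gi by (intro ideal.span_base imageI) auto
  qed
  have cong: "f - scal (eval_mpoly f v) (var i0 ^ d) \<in> ideal.span (G ` {1..n})" if "f \<in> forms d" for f d
    using that l_span unfolding l_def by (intro form_cong_power_var)
  have l_form: "l i \<in> forms 1" for i
    unfolding l_def by (intro mpoly.subspace_diff mpoly.subspace_scale forms_subspace var_in_forms)
  have vP: "v \<in> P" unfolding Pv by (simp add: vec.span_base)
  have eq: "vanishing_ideal {P} = ideal.span (G ` {1..n})"
  proof
    show "vanishing_ideal {P} \<subseteq> ideal.span (G ` {1..n})"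
      unfolding vanishing_ideal_def
    proof (intro ideal.span_minimal ideal.subspace_span subsetI)
      fix f :: "('a, 'v) mpoly" assume "f \<in> {f. (\<exists>d. f \<in> forms d) \<and> (\<forall>P\<in>{P}. \<forall>v\<in>P. eval_mpoly f v = 0)}"
      then obtain d where "f \<in> forms d" "eval_mpoly f v = 0" using vP by blast
      then show "f \<in> ideal.span (G ` {1..n})" using cong[of f d] by simp
    qed
    show "ideal.span (G ` {1..n}) \<subseteq> vanishing_ideal {P}"
    proof (intro ideal.span_minimal subsetI)
      fix f assume "f \<in> G ` {1..n}"
      then obtain i where i: "f = l i" unfolding Gi by blast
      have "eval_mpoly (l i) v = 0" using vi0 by (simp add: l_def eval_diff eval_scal eval_var)
      then show "f \<in> vanishing_ideal {P}"
        unfolding i using Pv by (intro vanishing_ideal_formI[OF l_form]) auto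
    qed (simp add: vanishing_ideal_def)
  qed
  have "hilbert (vanishing_ideal {P}) i \<le> 1" for i
  proof (cases "i < 0")
    case False
    have "quotient_dim (forms (nat i)) (vanishing_ideal {P}) \<le> card {nat i}"
    proof (rule quotient_dim_le_family[OF forms_subspace subset_refl, where b = "\<lambda>k. var i0 ^ k"])
      fix k assume "k \<in> {nat i}"
      then show "var i0 ^ k \<in> forms (nat i)" using power_in_forms[OF var_in_forms, of i0 k] by simp
    next
      fix f :: "('a, 'v) mpoly" assume "f \<in> forms (nat i)"
      then show "\<exists>c. f - (\<Sum>k\<in>{nat i}. scal (c k) (var i0 ^ k)) \<in> vanishing_ideal {P}"
        using cong eq by (intro exI[of _ "\<lambda>_. eval_mpoly f v"]) simp
    qed (simp_all add: eq ideal_span_subspace)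
    then show ?thesis using False by (simp add: hilbert_def)
  qed (simp add: hilbert_def)
  moreover have "G j \<in> forms 1" for j unfolding G_def by (rule l_form)
  ultimately show thesis using that eq by blast
qed

section \<open>Dependence on the multiplicities\<close>

lemma fat_ideal_subspace: "ideal.subspace (fat_ideal s P \<mu>)"
  unfolding fat_ideal_def by (intro ideal.subspace_Inter) (auto intro: ideal_power_subspace)

lemma fat_ideal_cong: "(\<And>j. j \<in> {1..s} \<Longrightarrow> \<mu> j = \<nu> j) \<Longrightarrow> fat_ideal s P \<mu> = fat_ideal s P \<nu>"
  by (simp add: fat_ideal_def)

lemma fat_ideal_antimono:
  assumes "\<And>j. j \<in> {1..s} \<Longrightarrow> \<mu> j \<le> \<nu> j" shows "fat_ideal s P \<nu> \<subseteq> fat_ideal s P \<mu>"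
  unfolding fat_ideal_def
proof (rule INT_anti_mono[OF subset_refl])
  fix j assume "j \<in> {1..s}"
  then show "ideal_power (vanishing_ideal {P j}) (\<nu> j) \<subseteq> ideal_power (vanishing_ideal {P j}) (\<mu> j)"
    using assms by (intro ideal_power_antimono)
qed

lemma hilbert_antimono:
  fixes J K :: "('a::field, 'v::finite) mpoly set"
  assumes "ideal.subspace J" "ideal.subspace K" "J \<subseteq> K"
  shows "hilbert K i \<le> hilbert J i"
proof -
  have "quotient_dim (forms k) J = quotient_dim (forms k) K + quotient_dim (forms k \<inter> K) J" for k
    using assms by (intro quotient_dim_chain[of _ k] forms_subspace ideal_imp_subspace) auto
  then show ?thesis by (simp add: hilbert_def)
qed

text \<open>Let p be the ideal of \<open>P k\<close> and u its multiplicity. The quotient of the two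
  fat ideals embeds in p^u/p^(u+1), which is generated over R/p by the products of degree u in n
  linear forms, and R/p has dimension at most 1 in each degree.\<close>

lemma hilbert_fat_ideal_step:
  fixes P :: "nat \<Rightarrow> ('a::field ^ 'v::finite) set"
  assumes n: "CARD('v) = n + 1" and k: "k \<in> {1..s}" and P: "P k \<in> proj_space"
  shows "hilbert (fat_ideal s P (\<mu>(k := Suc (\<mu> k)))) i \<le> hilbert (fat_ideal s P \<mu>) i + card (shell n (\<mu> k))"
proof (cases "i < 0")
  case False
  let ?d = "nat i" and ?K = "fat_ideal s P \<mu>" and ?J = "fat_ideal s P (\<mu>(k := Suc (\<mu> k)))"
  let ?p = "vanishing_ideal {P k}"
  obtain G where G: "\<And>j. j \<in> {1..n} \<Longrightarrow> G j \<in> forms 1" "?p = ideal.span (G ` {1..n})"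
    "\<And>i. hilbert ?p i \<le> 1"
    using point_ideal_generators[OF n P] by blast
  have V: "mpoly.subspace (forms ?d \<inter> ?K)" "mpoly.subspace (forms ?d \<inter> ideal_power ?p (\<mu> k))"
    by (intro mpoly.subspace_inter forms_subspace ideal_imp_subspace fat_ideal_subspace ideal_power_subspace)+
  have sub: "?J \<subseteq> ?K" by (intro fat_ideal_antimono) simp
  have "?K \<inter> ?J = ?K \<inter> ideal_power ?p (Suc (\<mu> k))"
  proof (intro equalityI subsetI)
    fix f assume "f \<in> ?K \<inter> ?J"
    then show "f \<in> ?K \<inter> ideal_power ?p (Suc (\<mu> k))"
      using k unfolding fat_ideal_def by (auto simp del: ideal_power.simps dest!: bspec[of _ _ k])
  next
    fix f assume f: "f \<in> ?K \<inter> ideal_power ?p (Suc (\<mu> k))"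
    have "f \<in> ideal_power (vanishing_ideal {P j}) ((\<mu>(k := Suc (\<mu> k))) j)" if "j \<in> {1..s}" for j
      using f that unfolding fat_ideal_def by (cases "j = k") (auto simp del: ideal_power.simps)
    then show "f \<in> ?K \<inter> ?J" using f unfolding fat_ideal_def by blast
  qed
  then have "quotient_dim (forms ?d \<inter> ?K) ?J = quotient_dim (forms ?d \<inter> ?K) (ideal_power ?p (Suc (\<mu> k)))"
    by (intro quotient_dim_cong[of _ ?d] V ideal_imp_subspace fat_ideal_subspace ideal_power_subspace) blast+
  also have "\<dots> \<le> quotient_dim (forms ?d \<inter> ideal_power ?p (\<mu> k)) (ideal_power ?p (Suc (\<mu> k)))"
    using k unfolding fat_ideal_def
    by (intro quotient_dim_mono[of _ _ ?d] V[unfolded fat_ideal_def] ideal_imp_subspace ideal_power_subspace) auto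
  also have "\<dots> \<le> (\<Sum>a\<in>shell n (\<mu> k). hilbert ?p (int ?d - int (weight n (\<lambda>_. 1) a)))"
    unfolding G(2) by (intro quotient_dim_ideal_power(1) G(1))
  also have "\<dots> \<le> (\<Sum>a\<in>shell n (\<mu> k). 1)" by (intro sum_mono G(3))
  finally have "quotient_dim (forms ?d \<inter> ?K) ?J \<le> card (shell n (\<mu> k))" by simp
  moreover have "quotient_dim (forms ?d) ?J = quotient_dim (forms ?d) ?K + quotient_dim (forms ?d \<inter> ?K) ?J"
    using sub by (intro quotient_dim_chain[of _ ?d] forms_subspace ideal_imp_subspace fat_ideal_subspace) auto
  ultimately show ?thesis using False by (simp add: hilbert_def)
qed (simp add: hilbert_def)

text \<open>Monotonicity of \<open>deg Z - H\<^sub>Z(i)\<close>, written without truncated subtraction.\<close>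

lemma hilbert_fat_ideal_defect:
  fixes P :: "nat \<Rightarrow> ('a::field ^ 'v::finite) set"
  assumes n: "CARD('v) = n + 1" and P: "P ` {1..s} \<subseteq> proj_space"
    and le: "\<And>j. j \<in> {1..s} \<Longrightarrow> \<mu> j \<le> \<nu> j"
  shows "hilbert (fat_ideal s P \<nu>) i + (\<Sum>j=1..s. card (lattice_simplex n (\<mu> j)))
    \<le> hilbert (fat_ideal s P \<mu>) i + (\<Sum>j=1..s. card (lattice_simplex n (\<nu> j)))"
  using le
proof (induction "\<Sum>j=1..s. \<nu> j - \<mu> j" arbitrary: \<mu>)
  case 0
  then have "\<mu> j = \<nu> j" if "j \<in> {1..s}" for j using that by (auto intro: antisym)
  then have "fat_ideal s P \<mu> = fat_ideal s P \<nu>"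
    "(\<Sum>j=1..s. card (lattice_simplex n (\<mu> j))) = (\<Sum>j=1..s. card (lattice_simplex n (\<nu> j)))"
    by (auto intro!: fat_ideal_cong sum.cong)
  then show ?case by simp
next
  case (Suc N)
  have "(\<Sum>j=1..s. \<nu> j - \<mu> j) \<noteq> 0" unfolding Suc.hyps(2)[symmetric] by simp
  then obtain k where k: "k \<in> {1..s}" "\<nu> k - \<mu> k \<noteq> 0" by (meson sum.neutral)
  let ?\<mu> = "\<mu>(k := Suc (\<mu> k))"
  have split: "(\<Sum>j=1..s. g j) = g k + (\<Sum>j\<in>{1..s} - {k}. g j)" for g :: "nat \<Rightarrow> nat"
    using k(1) by (simp add: sum.remove)
  have rest: "(\<Sum>j\<in>{1..s} - {k}. g j (?\<mu> j)) = (\<Sum>j\<in>{1..s} - {k}. g j (\<mu> j))" for g :: "nat \<Rightarrow> nat \<Rightarrow> nat"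
    by (intro sum.cong) auto
  have "N = (\<Sum>j=1..s. \<nu> j - ?\<mu> j)"
    using Suc.hyps(2) k(2) unfolding split rest[of "\<lambda>j m. \<nu> j - m"] by simp
  moreover have "?\<mu> j \<le> \<nu> j" if "j \<in> {1..s}" for j using Suc.prems[OF that] k(2) by auto
  ultimately have "hilbert (fat_ideal s P \<nu>) i + (\<Sum>j=1..s. card (lattice_simplex n (?\<mu> j)))
      \<le> hilbert (fat_ideal s P ?\<mu>) i + (\<Sum>j=1..s. card (lattice_simplex n (\<nu> j)))"
    by (rule Suc.hyps(1))
  moreover have "(\<Sum>j=1..s. card (lattice_simplex n (?\<mu> j))) =
      (\<Sum>j=1..s. card (lattice_simplex n (\<mu> j))) + card (shell n (\<mu> k))"
    unfolding split rest[of "\<lambda>j m. card (lattice_simplex n m)"]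
    by (simp add: lattice_simplex_Suc card_Un_disjoint finite_lattice_simplex finite_shell lattice_simplex_shell_disjoint)
  moreover have "hilbert (fat_ideal s P ?\<mu>) i \<le> hilbert (fat_ideal s P \<mu>) i + card (shell n (\<mu> k))"
    using k(1) P by (intro hilbert_fat_ideal_step n) auto
  ultimately show ?case by linarith
qed

text \<open>Compare with multiplicity 0 everywhere: the ideal is then the whole ring, with Hilbert
  function and degree 0.\<close>

lemma hilbert_fat_ideal_le:
  fixes P :: "nat \<Rightarrow> ('a::field ^ 'v::finite) set"
  assumes "CARD('v) = n + 1" "P ` {1..s} \<subseteq> proj_space"
  shows "hilbert (fat_ideal s P \<mu>) i \<le> (\<Sum>j=1..s. card (lattice_simplex n (\<mu> j)))"
  using hilbert_fat_ideal_defect[OF assms, of "\<lambda>_. 0" \<mu> i]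
  by (simp add: fat_ideal_def hilbert_UNIV lattice_simplex_0)

section \<open>Bounds for the initial degree and the regularity index\<close>

lemma ideal_power_subset_fat_ideal:
  "ideal_power (vanishing_ideal (P ` {1..s})) t \<subseteq> fat_ideal s P (\<lambda>_. t)"
  unfolding fat_ideal_def by (intro INT_greatest ideal_power_mono vanishing_ideal_antimono) auto

text \<open>For constant multiplicity the fat ideal and the ordinary power of the ideal of X contain
  the same forms. In negative degrees every shifted argument is negative too.\<close>

lemma hilbert_homogeneous_fat_ideal:
  fixes P :: "nat \<Rightarrow> ('a::field_char_0 ^ 'v::finite) set" and F :: "nat \<Rightarrow> ('a, 'v) mpoly"
  assumes n: "CARD('v) = n + 1" and P: "P ` {1..s} \<subseteq> proj_space"
    and F: "vanishing_ideal (P ` {1..s}) = ideal.span (F ` {1..n})" "\<And>j. j \<in> {1..n} \<Longrightarrow> F j \<in> forms (d j)"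
  shows "hilbert (fat_ideal s P (\<lambda>_. t)) i =
    (\<Sum>a\<in>lattice_simplex n t. hilbert (vanishing_ideal (P ` {1..s})) (i - (\<Sum>j=1..n. int (a j) * int (d j))))"
proof -
  let ?X = "P ` {1..s}"
  have w: "(\<Sum>j=1..n. int (a j) * int (d j)) = int (weight n d a)" for a
    by (simp add: weight_def)
  show ?thesis
  proof (cases "i < 0")
    case True
    then show ?thesis unfolding w by (simp add: hilbert_def)
  next
    case False
    then obtain k where k: "i = int k" using nonneg_int_cases by (metis not_less)
    have "f \<in> ideal_power (vanishing_ideal ?X) t" if "f \<in> forms k" "f \<in> fat_ideal s P (\<lambda>_. t)" for f
      using that(2) unfolding fat_ideal_def
      by (intro symbolic_power_eq_power[OF n P _ F that(1)]) auto
    with ideal_power_subset_fat_ideal[of P s t] have "forms k \<inter> fat_ideal s P (\<lambda>_. t) = forms k \<inter> ideal_power (vanishing_ideal ?X) t"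
      by blast
    then have "hilbert (fat_ideal s P (\<lambda>_. t)) i = hilbert (ideal_power (vanishing_ideal ?X) t) i"
      unfolding hilbert_def k
      by (simp add: quotient_dim_cong[of _ k] forms_subspace ideal_imp_subspace fat_ideal_subspace ideal_power_subspace)
    also have "\<dots> = (\<Sum>a\<in>lattice_simplex n t. hilbert (vanishing_ideal ?X) (i - int (weight n d a)))"
      unfolding k F(1)
      by (intro hilbert_ideal_power F(2)
          quasi_regular_reduced_points[OF n P finite_imageI[OF finite_atLeastAtMost] F(1)])
    finally show ?thesis unfolding w .
  qed
qed

text \<open>A nonzero form in I^m involves some product of m of the F_j of degree at most its own,
  and the cheapest one is F_1^m. Conversely F_1^M is nonzero and vanishes to order M at all
  points.\<close>

lemma initial_degree_bounds:
  fixes P :: "nat \<Rightarrow> ('a::field_char_0 ^ 'v::finite) set" and F :: "nat \<Rightarrow> ('a, 'v) mpoly"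
  assumes n: "CARD('v) = n + 1" "0 < n" and P: "P ` {1..s} \<subseteq> proj_space"
    and F: "vanishing_ideal (P ` {1..s}) = ideal.span (F ` {1..n})" "\<And>j. j \<in> {1..n} \<Longrightarrow> F j \<in> forms (d j)"
    and reg: "regular_sequence n F" and d: "mono_on {1..n} d"
    and m: "\<And>j. j \<in> {1..s} \<Longrightarrow> m \<le> \<mu> j" and M: "\<And>j. j \<in> {1..s} \<Longrightarrow> \<mu> j \<le> M"
  shows "m * d 1 \<le> initial_degree (fat_ideal s P \<mu>)" "initial_degree (fat_ideal s P \<mu>) \<le> M * d 1"
proof -
  let ?Z = "fat_ideal s P \<mu>" and ?X = "P ` {1..s}"
  have n1: "1 \<in> {1..n}" using n(2) by auto
  have "F 1 ^ k \<in> ideal_power (vanishing_ideal ?X) k" for k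
  proof (induction k)
    case (Suc k)
    have "F 1 \<in> vanishing_ideal ?X" unfolding F(1) using n1 by (intro ideal.span_base imageI)
    with Suc show ?case by (simp add: mult_mem_ideal_mult)
  qed simp
  then have "F 1 ^ M \<in> fat_ideal s P (\<lambda>_. M)"
    using ideal_power_subset_fat_ideal by blast
  then have inZ: "F 1 ^ M \<in> ?Z" using fat_ideal_antimono[of s \<mu> "\<lambda>_. M" P] M by auto
  \<comment> \<open>At index 1 the preceding ideal is generated by the empty set, so regularity says
    that \<open>F 1\<close> is not a zero divisor in R.\<close>
  have nzd: "g = 0" if "F 1 * g = 0" for g
    using reg n1 that unfolding regular_sequence_def by (auto dest!: bspec[of _ _ 1])
  have "F 1 ^ k \<noteq> 0" for k
  proof (induction k)
    case (Suc k)
    then show ?case using nzd[of "F 1 ^ k"] by auto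
  qed simp
  then have wit: "?Z \<inter> forms (M * d 1) \<noteq> {0}"
    using inZ power_in_forms[OF F(2)[OF n1], of M] by blast
  then show "initial_degree ?Z \<le> M * d 1" unfolding initial_degree_def by (rule Least_le)
  have "?Z \<inter> forms (initial_degree ?Z) \<noteq> {0}"
    unfolding initial_degree_def by (rule LeastI[of "\<lambda>i. ?Z \<inter> forms i \<noteq> {0}", OF wit])
  \<comment> \<open>The empty set also differs from \<open>{0}\<close>; only together with this
    membership does the inequality yield a nonzero element.\<close>
  moreover have "0 \<in> ?Z \<inter> forms (initial_degree ?Z)"
    using ideal.subspace_0[OF fat_ideal_subspace] mpoly.subspace_0[OF forms_subspace]
    by (simp add: forms_iff)
  ultimately obtain f where f: "f \<in> ?Z" "f \<in> forms (initial_degree ?Z)" "f \<noteq> 0" by blast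
  have "f \<in> fat_ideal s P (\<lambda>_. m)" using f(1) fat_ideal_antimono[of s "\<lambda>_. m" \<mu> P] m by auto
  then have "f \<in> ideal_power (vanishing_ideal ?X) m"
    unfolding fat_ideal_def by (intro symbolic_power_eq_power[OF n(1) P _ F f(2)]) auto
  then have "f \<in> ideal_power (ideal.span (F ` {1..n})) m" unfolding F(1) .
  then obtain c where c: "f = (\<Sum>a\<in>{a \<in> shell n m. weight n d a \<le> initial_degree ?Z}. c a * power_product n F a)"
    using ideal_power_homogeneous_representation[of n F d f "initial_degree ?Z" m] F(2) f(2) by blast
  have "{a \<in> shell n m. weight n d a \<le> initial_degree ?Z} \<noteq> {}"
    using f(3) unfolding c by (rule contrapos_nn) (simp only: sum.empty)
  then obtain a where a: "a \<in> shell n m" "weight n d a \<le> initial_degree ?Z" by blast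
  have "m * d 1 = (\<Sum>j=1..n. a j * d 1)"
    using a(1) by (simp add: shell_def flip: sum_distrib_right)
  also have "\<dots> \<le> weight n d a"
    unfolding weight_def using d n1 by (intro sum_mono mult_left_mono) (auto simp: mono_on_def)
  finally show "m * d 1 \<le> initial_degree ?Z" using a(2) by simp
qed

section \<open>Where the Hilbert function reaches the degree\<close>

lemma scheme_degree_eq:
  assumes "0 < n" shows "scheme_degree n s \<mu> = (\<Sum>j=1..s. card (lattice_simplex n (\<mu> j)))"
  by (simp add: scheme_degree_def card_lattice_simplex[OF assms])

lemma sum_eq_bound_iff:
  fixes f :: "'b \<Rightarrow> nat"
  assumes "finite A" "\<And>a. a \<in> A \<Longrightarrow> f a \<le> k"
  shows "(\<Sum>a\<in>A. f a) = card A * k \<longleftrightarrow> (\<forall>a\<in>A. f a = k)"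
proof
  assume s: "(\<Sum>a\<in>A. f a) = card A * k"
  show "\<forall>a\<in>A. f a = k"
  proof (rule ccontr)
    assume "\<not> (\<forall>a\<in>A. f a = k)"
    then obtain b where "b \<in> A" "f b < k" using assms(2) by (metis nat_less_le)
    then have "(\<Sum>a\<in>A. f a) < (\<Sum>a\<in>A. k)" using assms by (intro sum_strict_mono_ex1) auto
    with s show False by simp
  qed
qed simp

text \<open>The degree is |X| times the number of summands, and each summand is at most |X|, so all
  of them must be maximal. The binding one has the largest shift; as the d_j increase, this is (t -
  1) d_n.\<close>

lemma hilbert_homogeneous_fat_ideal_max_iff:
  fixes P :: "nat \<Rightarrow> ('a::field_char_0 ^ 'v::finite) set" and F :: "nat \<Rightarrow> ('a, 'v) mpoly"
  assumes n: "CARD('v) = n + 1" "0 < n" and P: "P ` {1..s} \<subseteq> proj_space"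
    and F: "vanishing_ideal (P ` {1..s}) = ideal.span (F ` {1..n})" "\<And>j. j \<in> {1..n} \<Longrightarrow> F j \<in> forms (d j)"
    and reg: "regular_sequence n F" and d: "mono_on {1..n} d" "\<And>j. j \<in> {1..n} \<Longrightarrow> 0 < d j"
    and s: "s = (\<Prod>j=1..n. d j)" and t: "0 < t"
  shows "hilbert (fat_ideal s P (\<lambda>_. t)) i = scheme_degree n s (\<lambda>_. t) \<longleftrightarrow>
    (\<Sum>j=1..<n. int (d j)) + int t * int (d n) - int n \<le> i"
proof -
  let ?I = "vanishing_ideal (P ` {1..s})" and ?w = "\<lambda>a. \<Sum>j=1..n. int (a j) * int (d j)"
  let ?L = "lattice_simplex n t"
  have nn: "n \<in> {1..n}" using n(2) by auto
  have "hilbert (ideal.span (F ` {1..n})) i \<le> (\<Prod>j=1..n. d j)" for i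
    by (intro hilbert_ci_le(1) n F reg d)
  then have H1: "hilbert ?I i \<le> s" for i unfolding F(1) s[symmetric] .
  have "hilbert (ideal.span (F ` {1..n})) i = (\<Prod>j=1..n. d j) \<longleftrightarrow> (\<Sum>j=1..n. int (d j)) - int n \<le> i" for i
    by (intro hilbert_ci_le(2) n F reg d)
  then have H2: "hilbert ?I i = s \<longleftrightarrow> (\<Sum>j=1..n. int (d j)) - int n \<le> i" for i
    unfolding F(1) s[symmetric] .
  have E: "hilbert (fat_ideal s P (\<lambda>_. t)) i = (\<Sum>a\<in>?L. hilbert ?I (i - ?w a))"
    by (rule hilbert_homogeneous_fat_ideal[OF n(1) P F(1)]) (rule F(2))
  have "hilbert (fat_ideal s P (\<lambda>_. t)) i = scheme_degree n s (\<lambda>_. t) \<longleftrightarrow>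
      (\<Sum>a\<in>?L. hilbert ?I (i - ?w a)) = card ?L * s"
    unfolding scheme_degree_eq[OF n(2)] E by (simp add: mult.commute)
  also have "\<dots> \<longleftrightarrow> (\<forall>a\<in>?L. hilbert ?I (i - ?w a) = s)"
    by (intro sum_eq_bound_iff finite_lattice_simplex H1)
  also have "\<dots> \<longleftrightarrow> (\<forall>a\<in>?L. (\<Sum>j=1..n. int (d j)) - int n + ?w a \<le> i)"
    unfolding H2 by (intro ball_cong) auto
  also have "\<dots> \<longleftrightarrow> (\<Sum>j=1..n. int (d j)) - int n + (int t - 1) * int (d n) \<le> i"
  proof
    assume *: "\<forall>a\<in>?L. (\<Sum>j=1..n. int (d j)) - int n + ?w a \<le> i"
    \<comment> \<open>The extremal tuple puts the whole sum t - 1 on the last coordinate.\<close>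
    define a where "a = (\<lambda>j\<in>{1..n}. if j = n then t - 1 else 0)"
    have aj: "a j = (if j = n then t - 1 else 0)" if "j \<in> {1..n}" for j using that by (simp add: a_def)
    have "(\<Sum>j=1..n. a j) = t - 1" using aj nn by simp
    then have "a \<in> ?L" using t unfolding lattice_simplex_def by (auto simp: a_def)
    moreover have "?w a = (\<Sum>j=1..n. if j = n then (int t - 1) * int (d n) else 0)"
      using t by (intro sum.cong) (auto simp: aj of_nat_diff)
    then have "?w a = (int t - 1) * int (d n)" using nn by simp
    ultimately show "(\<Sum>j=1..n. int (d j)) - int n + (int t - 1) * int (d n) \<le> i" using * by metis
  next
    assume *: "(\<Sum>j=1..n. int (d j)) - int n + (int t - 1) * int (d n) \<le> i"
    show "\<forall>a\<in>?L. (\<Sum>j=1..n. int (d j)) - int n + ?w a \<le> i"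
    proof
      fix a assume a: "a \<in> ?L"
      have "?w a \<le> (\<Sum>j=1..n. int (a j) * int (d n))"
        using d(1) nn by (intro sum_mono mult_left_mono) (auto simp: mono_on_def)
      also have "\<dots> = int (\<Sum>j=1..n. a j) * int (d n)" by (simp add: sum_distrib_right)
      also have "\<dots> \<le> (int t - 1) * int (d n)"
        using a by (intro mult_right_mono) (auto simp: lattice_simplex_def simp flip: of_nat_sum)
      finally show "(\<Sum>j=1..n. int (d j)) - int n + ?w a \<le> i" using * by linarith
    qed
  qed
  also have "(\<Sum>j=1..n. int (d j)) = (\<Sum>j=1..<n. int (d j)) + int (d n)"
    using n(2) by (simp add: sum.last_plus add.commute)
  finally show ?thesis by (simp add: algebra_simps)
qed

text \<open>The defect deg - H is nonnegative and cannot grow when multiplicities are lowered, so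
  reaching the degree passes from the constant M to \<mu> and from \<mu> to the constant m.\<close>

lemma regularity_index_bounds:
  fixes P :: "nat \<Rightarrow> ('a::field_char_0 ^ 'v::finite) set" and F :: "nat \<Rightarrow> ('a, 'v) mpoly"
  assumes n: "CARD('v) = n + 1" "0 < n" and P: "P ` {1..s} \<subseteq> proj_space"
    and F: "vanishing_ideal (P ` {1..s}) = ideal.span (F ` {1..n})" "\<And>j. j \<in> {1..n} \<Longrightarrow> F j \<in> forms (d j)"
    and reg: "regular_sequence n F" and d: "mono_on {1..n} d" "\<And>j. j \<in> {1..n} \<Longrightarrow> 0 < d j"
    and s: "s = (\<Prod>j=1..n. d j)" and m0: "0 < m" and mM: "m \<le> M"
    and m: "\<And>j. j \<in> {1..s} \<Longrightarrow> m \<le> \<mu> j" and M: "\<And>j. j \<in> {1..s} \<Longrightarrow> \<mu> j \<le> M"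
  shows "(\<Sum>j=1..<n. int (d j)) + int m * int (d n) - int n \<le> int (regularity_index n s P \<mu>)"
    "int (regularity_index n s P \<mu>) \<le> (\<Sum>j=1..<n. int (d j)) + int M * int (d n) - int n"
proof -
  let ?deg = "\<lambda>\<mu>. scheme_degree n s \<mu>"
  have inherit: "hilbert (fat_ideal s P \<mu>') i = ?deg \<mu>'"
    if "hilbert (fat_ideal s P \<nu>) i = ?deg \<nu>" "\<And>j. j \<in> {1..s} \<Longrightarrow> \<mu>' j \<le> \<nu> j" for \<mu>' \<nu> i
  proof -
    have "hilbert (fat_ideal s P \<nu>) i + ?deg \<mu>' \<le> hilbert (fat_ideal s P \<mu>') i + ?deg \<nu>"
      unfolding scheme_degree_eq[OF n(2)] using that(2) by (intro hilbert_fat_ideal_defect n(1) P)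
    moreover have "hilbert (fat_ideal s P \<mu>') i \<le> ?deg \<mu>'"
      unfolding scheme_degree_eq[OF n(2)] by (intro hilbert_fat_ideal_le n(1) P)
    ultimately show ?thesis using that(1) by linarith
  qed
  have max_iff: "hilbert (fat_ideal s P (\<lambda>_. t)) i = ?deg (\<lambda>_. t) \<longleftrightarrow>
      (\<Sum>j=1..<n. int (d j)) + int t * int (d n) - int n \<le> i" if "0 < t" for t i
    by (intro hilbert_homogeneous_fat_ideal_max_iff[where F = F] n P F reg d s that)
  let ?N = "(\<Sum>j=1..<n. int (d j)) + int M * int (d n) - int n"
  have M0: "0 < M" using m0 mM by simp
  \<comment> \<open>The bound has to be nonnegative to serve as a witness for a least natural
    number: n - 1 degrees and M d_n, each at least 1, add up to at least n.\<close>
  have "(\<Sum>j=1..<n. 1) \<le> (\<Sum>j=1..<n. int (d j))" using d(2) by (intro sum_mono) (auto simp: Suc_le_eq)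
  moreover have "1 \<le> int M * int (d n)" using M0 d(2)[of n] n(2) by (simp flip: of_nat_mult add: Suc_le_eq)
  ultimately have "0 \<le> ?N" using n(2) by (simp add: of_nat_diff)
  then have N: "?N = int (nat ?N)" by simp
  have "hilbert (fat_ideal s P (\<lambda>_. M)) (int (nat ?N)) = ?deg (\<lambda>_. M)"
    unfolding N[symmetric] max_iff[OF M0] by simp
  then have wit: "hilbert (fat_ideal s P \<mu>) (int (nat ?N)) = ?deg \<mu>" by (rule inherit) (rule M)
  then have "regularity_index n s P \<mu> \<le> nat ?N" unfolding regularity_index_def by (rule Least_le)
  then show "int (regularity_index n s P \<mu>) \<le> ?N" using N by linarith
  have "hilbert (fat_ideal s P \<mu>) (int (regularity_index n s P \<mu>)) = ?deg \<mu>"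
    unfolding regularity_index_def by (rule LeastI[of "\<lambda>i. hilbert (fat_ideal s P \<mu>) (int i) = ?deg \<mu>", OF wit])
  then have "hilbert (fat_ideal s P (\<lambda>_. m)) (int (regularity_index n s P \<mu>)) = ?deg (\<lambda>_. m)"
    by (rule inherit) (rule m)
  then show "(\<Sum>j=1..<n. int (d j)) + int m * int (d n) - int n \<le> int (regularity_index n s P \<mu>)"
    unfolding max_iff[OF m0] .
qed

theorem proposition4p3:
  fixes n s M m :: nat
    and P :: "nat \<Rightarrow> ('a::{alg_closed_field, field_char_0} ^ 'v::finite) set"
    and \<mu> d :: "nat \<Rightarrow> nat"
    and X :: "('a ^ 'v) set set"
  assumes dim: "CARD('v) = n + 1"
    and Z: "fat_point_scheme s P \<mu>"
    and nonhom: "\<not> homogeneous_scheme s \<mu>"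
    and supp: "X = P ` {1..s}"
    and CI: "complete_intersection n d X"
    and M: "M = Max (\<mu> ` {1..s})"
    and m: "m = Min (\<mu> ` {1..s})"
  shows
    "(\<forall>i::int.
        (\<Sum>a\<in>lattice_simplex n m. hilbert (vanishing_ideal X) (i - (\<Sum>j=1..n. int (a j) * int (d j))))
          \<le> hilbert (fat_ideal s P \<mu>) i \<and>
        hilbert (fat_ideal s P \<mu>) i
          \<le> (\<Sum>a\<in>lattice_simplex n M. hilbert (vanishing_ideal X) (i - (\<Sum>j=1..n. int (a j) * int (d j)))))
     \<and> (m * d 1 \<le> initial_degree (fat_ideal s P \<mu>) \<and>
        initial_degree (fat_ideal s P \<mu>) \<le> M * d 1)
     \<and> ((\<Sum>j=1..<n. int (d j)) + int m * int (d n) - int n \<le> int (regularity_index n s P \<mu>) \<and>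
        int (regularity_index n s P \<mu>) \<le> (\<Sum>j=1..<n. int (d j)) + int M * int (d n) - int n)"
proof -
  have P: "P ` {1..s} \<subseteq> proj_space" and inj: "inj_on P {1..s}" and pos: "\<And>j. j \<in> {1..s} \<Longrightarrow> 0 < \<mu> j"
    using Z by (auto simp: fat_point_scheme_def)
  obtain F where F: "\<And>j. j \<in> {1..n} \<Longrightarrow> F j \<in> forms (d j)" and reg: "regular_sequence n F"
    and XF: "vanishing_ideal (P ` {1..s}) = ideal.span (F ` {1..n})"
    using CI unfolding complete_intersection_def supp by blast
  have mono: "mono_on {1..n} d" and "card X = (\<Prod>j=1..n. d j)"
    using CI by (auto simp: complete_intersection_def)
  then have s: "s = (\<Prod>j=1..n. d j)" using inj by (simp add: supp card_image)
  obtain j1 j2 where j: "j1 \<in> {1..s}" "j2 \<in> {1..s}" "\<mu> j1 \<noteq> \<mu> j2"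
    using nonhom by (auto simp: homogeneous_scheme_def)
  then have "j1 \<noteq> j2" by auto
  then have s2: "s \<noteq> 1" "s \<noteq> 0" using j(1,2) by auto
  \<comment> \<open>For \<open>n = 0\<close> the empty product would give a single point, but two
    different multiplicities need two points.\<close>
  then have n0: "0 < n" using s by (cases n) auto
  \<comment> \<open>A degree 0 would make the number of points 0.\<close>
  have d0: "0 < d j" if "j \<in> {1..n}" for j
    using s s2(2) that by (metis finite_atLeastAtMost gr0I prod_zero_iff)
  have bounds: "m \<le> \<mu> j" "\<mu> j \<le> M" if "j \<in> {1..s}" for j
    using that by (auto simp: m M)
  have "m \<in> \<mu> ` {1..s}" unfolding m using s2 by (intro Min_in) auto
  then have m0: "0 < m" and mM: "m \<le> M" using pos bounds by auto
  have E: "hilbert (fat_ideal s P (\<lambda>_. t)) i =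
      (\<Sum>a\<in>lattice_simplex n t. hilbert (vanishing_ideal X) (i - (\<Sum>j=1..n. int (a j) * int (d j))))" for t i
    unfolding supp by (rule hilbert_homogeneous_fat_ideal[OF dim P XF]) (rule F)
  have "(\<Sum>a\<in>lattice_simplex n m. hilbert (vanishing_ideal X) (i - (\<Sum>j=1..n. int (a j) * int (d j))))
      \<le> hilbert (fat_ideal s P \<mu>) i" for i
    unfolding E[symmetric]
    by (intro hilbert_antimono fat_ideal_subspace fat_ideal_antimono bounds)
  moreover have "hilbert (fat_ideal s P \<mu>) i
      \<le> (\<Sum>a\<in>lattice_simplex n M. hilbert (vanishing_ideal X) (i - (\<Sum>j=1..n. int (a j) * int (d j))))" for i
    unfolding E[symmetric]
    by (intro hilbert_antimono fat_ideal_subspace fat_ideal_antimono bounds)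
  moreover have "m * d 1 \<le> initial_degree (fat_ideal s P \<mu>)"
    by (rule initial_degree_bounds(1)[OF dim n0 P XF F reg mono bounds])
  moreover have "initial_degree (fat_ideal s P \<mu>) \<le> M * d 1"
    by (rule initial_degree_bounds(2)[OF dim n0 P XF F reg mono bounds])
  moreover have "(\<Sum>j=1..<n. int (d j)) + int m * int (d n) - int n \<le> int (regularity_index n s P \<mu>)"
    by (rule regularity_index_bounds(1)[OF dim n0 P XF F reg mono d0 s m0 mM bounds])
  moreover have "int (regularity_index n s P \<mu>) \<le> (\<Sum>j=1..<n. int (d j)) + int M * int (d n) - int n"
    by (rule regularity_index_bounds(2)[OF dim n0 P XF F reg mono d0 s m0 mM bounds])
  ultimately show ?thesis by blast
qed

end
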